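(* For $k\ge 0$ let $W_k=\mathfrak{b}(4k+4,2k+1)$ be the $k$-twisted Whitehead link, use the coordinates $(x,y,z)=(\mathrm{tr}\,\rho(a),\mathrm{tr}\,\rho(b),\mathrm{tr}\,\rho(ab))$ on its character variety, and let $\gamma=x^2+y^2+z^2-xyz-2$. (i) For every integer $n\ge 1$, the character variety of $W_{2n-1}$ is the zero set in $\mathbb{C}^3$ of the polynomial $$(\gamma-2)\big((xy-\gamma z)S_{n-1}(\gamma)-(xy-2z)S_{n-2}(\gamma)\big)\prod_{j=1}^{n-1}\Big(\gamma-2\cos\frac{j\pi}{n}\Big),$$ and it has exactly $n+1$ irreducible components. (ii) For every integer $n\ge 0$, the character variety of $W_{2n}$ is the zero set in $\mathbb{C}^3$ of the polynomial $$(\gamma-2)\big(zS_n(\gamma)-(xy-z)S_{n-1}(\gamma)\big)\prod_{j=1}^{n}\Big(\gamma-2\cos\frac{(2j-1)\pi}{2n+1}\Big),$$ and it has exactly $n+2$ irreducible components.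
   Context: For relatively prime integers $p>m>0$ with $m$ odd, $\mathfrak{b}(2p,m)$ denotes the associated two-bridge link. Its link group is $\pi=\langle a,b\mid aw=wa\rangle$, where $a,b$ are meridians, $w=b^{\varepsilon_1}a^{\varepsilon_2}\cdots a^{\varepsilon_{2p-2}}b^{\varepsilon_{2p-1}}$ (letters alternating $b,a,b,\dots,a,b$) and $\varepsilon_j=(-1)^{\lfloor mj/(2p)\rfloor}$. The $k$-twisted Whitehead link $W_k$ is the two-bridge link $\mathfrak{b}(4k+4,2k+1)$ ($W_0$ is the $(2,4)$-torus link and $W_1$ is the Whitehead link). The character variety of a finitely generated group $G$ is the algebro-geometric quotient of $\mathrm{Hom}(G,SL_2(\mathbb{C}))$ by conjugation; its points are in bijection with the characters of representations $G\to SL_2(\mathbb{C})$. For $G$ generated by two elements $a,b$, a character is determined by $x=\mathrm{tr}\,\rho(a)$, $y=\mathrm{tr}\,\rho(b)$, $z=\mathrm{tr}\,\rho(ab)$, so the character variety is identified with the algebraic subset of $\mathbb{C}^3$ consisting of all such triples $(x,y,z)$, $\rho$ ranging over representations $G\to SL_2(\mathbb{C})$. The character variety of a link is that of its link group. The Chebyshev polynomials $S_k(t)$, $k\in\mathbb{Z}$, are defined by $S_0(t)=1$, $S_1(t)=t$ and $S_{k+1}(t)=tS_k(t)-S_{k-1}(t)$ for all integers $k$ (so $S_{-1}=0$). Empty products equal $1$. *)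

theory Defs
  imports
    "HOL-Analysis.Analysis"
    "HOL-Algebra.Group"
    "HOL-Computational_Algebra.Polynomial"
begin

section \<open>Group presentations\<close>

text \<open>A letter \<open>(g, True)\<close> is the generator \<open>g\<close>, and \<open>(g, False)\<close> is its inverse.\<close>

type_synonym 'g word = "('g \<times> bool) list"

inductive word_eq :: "('g word \<times> 'g word) set \<Rightarrow> 'g word \<Rightarrow> 'g word \<Rightarrow> bool"
  for R :: "('g word \<times> 'g word) set" where
  refl: "word_eq R u u"
| sym: "word_eq R u v \<Longrightarrow> word_eq R v u"
| trans: "word_eq R u v \<Longrightarrow> word_eq R v w \<Longrightarrow> word_eq R u w"
| append: "word_eq R u u' \<Longrightarrow> word_eq R v v' \<Longrightarrow> word_eq R (u @ v) (u' @ v')"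
| cancel: "word_eq R [(g, s), (g, \<not> s)] []"
| relation: "(u, v) \<in> R \<Longrightarrow> word_eq R u v"

definition word_class :: "('g word \<times> 'g word) set \<Rightarrow> 'g word \<Rightarrow> 'g word set" where
  "word_class R u = {v. word_eq R u v}"

definition presented_group :: "('g word \<times> 'g word) set \<Rightarrow> 'g word set monoid" where
  "presented_group R =
    \<lparr> carrier = range (word_class R),
      mult = (\<lambda>X Y. {w. \<exists>u\<in>X. \<exists>v\<in>Y. word_eq R (u @ v) w}),
      one = word_class R [] \<rparr>"

definition gen_elem :: "('g word \<times> 'g word) set \<Rightarrow> 'g \<Rightarrow> 'g word set" where
  "gen_elem R g = word_class R [(g, True)]"

lemma word_class_eq_iff: "word_class R u = word_class R v \<longleftrightarrow> word_eq R u v"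
  unfolding word_class_def by (auto intro: word_eq.intros)

lemma presented_mult:
  "word_class R u \<otimes>\<^bsub>presented_group R\<^esub> word_class R v = word_class R (u @ v)"
  unfolding presented_group_def word_class_def
  by (auto intro: word_eq.intros)

lemma group_presented_group: "group (presented_group R)"
proof (rule groupI)
  fix X assume "X \<in> carrier (presented_group R)"
  then obtain u where X: "X = word_class R u"
    by (auto simp: presented_group_def)
  have "word_eq R (rev (map (\<lambda>(g, s). (g, \<not> s)) u) @ u) []"
  proof (induction u)
    case Nil
    show ?case by (simp add: word_eq.refl)
  next
    case (Cons l u)
    obtain g s where l: "l = (g, s)" by (cases l)
    let ?v = "rev (map (\<lambda>(g, s). (g, \<not> s)) u)"
    have "word_eq R [(g, \<not> s), (g, s)] []"
      using word_eq.cancel[of R g "\<not> s"] by simp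
    then have "word_eq R (?v @ ([(g, \<not> s), (g, s)] @ u)) (?v @ ([] @ u))"
      by (intro word_eq.append word_eq.refl)
    with Cons show ?case
      by (auto simp: l intro: word_eq.trans)
  qed
  then show "\<exists>Y\<in>carrier (presented_group R). Y \<otimes>\<^bsub>presented_group R\<^esub> X = \<one>\<^bsub>presented_group R\<^esub>"
    unfolding X
  proof (intro bexI)
    show "word_class R (rev (map (\<lambda>(g, s). (g, \<not> s)) u)) \<in> carrier (presented_group R)"
      unfolding presented_group_def partial_object.simps by (rule rangeI)
  qed (simp add: presented_mult, simp add: presented_group_def word_class_eq_iff)
next
  show "\<one>\<^bsub>presented_group R\<^esub> \<in> carrier (presented_group R)"
    by (simp add: presented_group_def)
next
  fix X Y assume "X \<in> carrier (presented_group R)" "Y \<in> carrier (presented_group R)"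
  then obtain u v where X: "X = word_class R u" and Y: "Y = word_class R v"
    by (auto simp: presented_group_def)
  show "X \<otimes>\<^bsub>presented_group R\<^esub> Y \<in> carrier (presented_group R)"
    unfolding X Y presented_mult by (simp add: presented_group_def)
next
  fix X Y Z
  assume "X \<in> carrier (presented_group R)" "Y \<in> carrier (presented_group R)"
    "Z \<in> carrier (presented_group R)"
  then obtain u v w where XYZ: "X = word_class R u" "Y = word_class R v" "Z = word_class R w"
    by (auto simp: presented_group_def)
  show "X \<otimes>\<^bsub>presented_group R\<^esub> Y \<otimes>\<^bsub>presented_group R\<^esub> Z =
      X \<otimes>\<^bsub>presented_group R\<^esub> (Y \<otimes>\<^bsub>presented_group R\<^esub> Z)"
    by (simp add: XYZ presented_mult)
next
  fix X assume "X \<in> carrier (presented_group R)"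
  then obtain u where X: "X = word_class R u"
    by (auto simp: presented_group_def)
  have "\<one>\<^bsub>presented_group R\<^esub> = word_class R []"
    by (simp add: presented_group_def)
  then show "\<one>\<^bsub>presented_group R\<^esub> \<otimes>\<^bsub>presented_group R\<^esub> X = X"
    by (simp add: X presented_mult)
qed

section \<open>Two-bridge links\<close>

datatype meridian = Mer_a | Mer_b

text \<open>
  The \<open>j\<close>-th letter (\<open>1 \<le> j \<le> 2p - 1\<close>) of the word \<open>w\<close> of \<open>\<bb>(2p,m)\<close> has exponent
  \<open>(-1)^\<lfloor>mj/(2p)\<rfloor>\<close>, which is \<open>1\<close> exactly when the floor is even.
\<close>

definition two_bridge_word :: "nat \<Rightarrow> nat \<Rightarrow> meridian word" where
  "two_bridge_word p m =
    map (\<lambda>j. (if odd j then Mer_b else Mer_a, even \<lfloor>real (m * j) / real (2 * p)\<rfloor>)) [1..<2 * p]"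

definition two_bridge_relations :: "nat \<Rightarrow> nat \<Rightarrow> (meridian word \<times> meridian word) set" where
  "two_bridge_relations p m =
    {([(Mer_a, True)] @ two_bridge_word p m, two_bridge_word p m @ [(Mer_a, True)])}"

text \<open>\<open>W\<^sub>k = \<bb>(4k+4, 2k+1)\<close>, that is \<open>p = 2k + 2\<close> and \<open>m = 2k + 1\<close>.\<close>

definition whitehead_relations :: "nat \<Rightarrow> (meridian word \<times> meridian word) set" where
  "whitehead_relations k = two_bridge_relations (2 * k + 2) (2 * k + 1)"

lemma whitehead_parameters:
  fixes k :: nat
  shows "2 * (2 * k + 2) = 4 * k + 4" "coprime (2 * k + 2) (2 * k + 1)"
    "2 * k + 1 < 2 * k + 2" "0 < 2 * k + 1" "odd (2 * k + 1)"
  using coprime_Suc_left_nat[of "2 * k + 1"] by simp_all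

section \<open>Character varieties\<close>

definition SL2C :: "(complex^2^2) monoid" where
  "SL2C = \<lparr> carrier = {A. det A = 1}, mult = (**), one = mat 1 \<rparr>"

lemma group_SL2C: "group SL2C"
proof (rule groupI)
  fix A assume "A \<in> carrier SL2C"
  then have d: "det A = 1" by (simp add: SL2C_def)
  then obtain B where B: "B ** A = mat 1"
    by (metis invertible_def invertible_det_nz zero_neq_one)
  then have "det B * det A = 1"
    by (metis det_I det_mul)
  with d B show "\<exists>B\<in>carrier SL2C. B \<otimes>\<^bsub>SL2C\<^esub> A = \<one>\<^bsub>SL2C\<^esub>"
    by (auto simp: SL2C_def)
qed (auto simp: SL2C_def det_mul matrix_mul_assoc)

text \<open>The character variety of \<open>G = \<langle>a, b\<rangle>\<close> in the coordinates \<open>(tr \<rho>(a), tr \<rho>(b), tr \<rho>(ab))\<close>.\<close>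

definition character_variety ::
    "('g, 'm) monoid_scheme \<Rightarrow> 'g \<Rightarrow> 'g \<Rightarrow> (complex \<times> complex \<times> complex) set" where
  "character_variety G a b =
    {(trace (\<rho> a), trace (\<rho> b), trace (\<rho> (a \<otimes>\<^bsub>G\<^esub> b))) | \<rho>. \<rho> \<in> hom G SL2C}"

definition whitehead_character_variety :: "nat \<Rightarrow> (complex \<times> complex \<times> complex) set" where
  "whitehead_character_variety k =
    (let R = whitehead_relations k
     in character_variety (presented_group R) (gen_elem R Mer_a) (gen_elem R Mer_b))"

section \<open>Algebraic subsets of \<open>\<complex>\<^sup>3\<close> and their irreducible components\<close>

text \<open>\<open>complex poly poly poly\<close> serves as \<open>\<complex>[x,y,z]\<close>, with \<open>x\<close> the outermost variable.\<close>

definition eval3 :: "complex poly poly poly \<Rightarrow> complex \<times> complex \<times> complex \<Rightarrow> complex" where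
  "eval3 P = (\<lambda>(x, y, z). poly (poly (poly P [:[:x:]:]) [:y:]) z)"

definition zero_locus :: "complex poly poly poly set \<Rightarrow> (complex \<times> complex \<times> complex) set" where
  "zero_locus F = {v. \<forall>P\<in>F. eval3 P v = 0}"

definition algebraic_set :: "(complex \<times> complex \<times> complex) set \<Rightarrow> bool" where
  "algebraic_set V \<longleftrightarrow> (\<exists>F. V = zero_locus F)"

definition irreducible_algebraic_set :: "(complex \<times> complex \<times> complex) set \<Rightarrow> bool" where
  "irreducible_algebraic_set V \<longleftrightarrow> algebraic_set V \<and> V \<noteq> {} \<and>
    (\<forall>V1 V2. algebraic_set V1 \<and> algebraic_set V2 \<and> V = V1 \<union> V2 \<longrightarrow> V = V1 \<or> V = V2)"

definition irreducible_components ::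
    "(complex \<times> complex \<times> complex) set \<Rightarrow> (complex \<times> complex \<times> complex) set set" where
  "irreducible_components V =
    {C. irreducible_algebraic_set C \<and> C \<subseteq> V \<and>
      (\<forall>D. irreducible_algebraic_set D \<and> D \<subseteq> V \<and> C \<subseteq> D \<longrightarrow> D = C)}"

section \<open>Chebyshev polynomials\<close>

text \<open>
  \<open>chebyshev_S_aux i\<close> is \<open>S\<^bsub>i-1\<^esub>\<close> for \<open>i \<ge> 0\<close>; the recurrence forces
  \<open>S\<^bsub>-i-1\<^esub> = - S\<^bsub>i-1\<^esub>\<close>, so this extends to all integers by oddness in \<open>k + 1\<close>.
\<close>

fun chebyshev_S_aux :: "nat \<Rightarrow> complex \<Rightarrow> complex" where
  "chebyshev_S_aux 0 t = 0"
| "chebyshev_S_aux (Suc 0) t = 1"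
| "chebyshev_S_aux (Suc (Suc i)) t = t * chebyshev_S_aux (Suc i) t - chebyshev_S_aux i t"

definition chebyshev_S :: "int \<Rightarrow> complex \<Rightarrow> complex" where
  "chebyshev_S k t =
    (if k \<ge> -1 then chebyshev_S_aux (nat (k + 1)) t else - chebyshev_S_aux (nat (- k - 1)) t)"

lemma chebyshev_S_initial: "chebyshev_S 0 t = 1" "chebyshev_S 1 t = t"
  by (simp_all add: chebyshev_S_def numeral_2_eq_2)

lemma chebyshev_S_rec: "chebyshev_S (k + 1) t = t * chebyshev_S k t - chebyshev_S (k - 1) t"
proof -
  consider "k \<ge> 0" | "k = -1" | "k \<le> -2" by linarith
  then show ?thesis
  proof cases
    case 1
    then obtain i where "k = int i" by (metis nat_0_le)
    then show ?thesis
      by (simp add: chebyshev_S_def nat_add_distrib numeral_2_eq_2)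
  next
    case 2
    then show ?thesis by (simp add: chebyshev_S_def)
  next
    case 3
    define i where "i = nat (- k - 2)"
    have k: "k = - int i - 2" using 3 by (simp add: i_def)
    have n: "nat (1 + int i) = Suc i" "nat (2 + int i) = Suc (Suc i)" by simp_all
    show ?thesis
      by (cases "i = 0") (simp_all add: chebyshev_S_def k n numeral_2_eq_2)
  qed
qed

section \<open>The polynomial \<open>\<gamma>\<close>\<close>

definition gamma_xyz :: "complex \<Rightarrow> complex \<Rightarrow> complex \<Rightarrow> complex" where
  "gamma_xyz x y z = x\<^sup>2 + y\<^sup>2 + z\<^sup>2 - x * y * z - 2"

end

theory Submission
  imports Defs "HOL-Computational_Algebra.Fundamental_Theorem_Algebra"
begin

text \<open>
  The word \<open>w\<close> is a palindrome, so for \<open>A, B \<in> SL\<^sub>2(\<complex>)\<close> it evaluates to some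
  \<open>W = \<alpha> + \<beta> A + \<delta> B\<close> with coefficients polynomial in \<open>(x, y, z)\<close>, and \<open>AW - WA = \<delta> (AB - BA)\<close>.
  Hence the character variety is \<open>\<gamma> = 2\<close> (characters of commuting pairs) together with \<open>\<delta> = 0\<close>.
  Since \<open>w\<close> is \<open>C\<^sup>n a C'\<^sup>n\<close> or \<open>C\<^sup>n bab C'\<^sup>n\<close> with \<open>C = bab\<^sup>-\<^sup>1a\<^sup>-\<^sup>1\<close>, \<open>C' = a\<^sup>-\<^sup>1b\<^sup>-\<^sup>1ab\<close> of trace \<open>\<gamma>\<close>, the
  Cayley--Hamilton formula for \<open>C\<^sup>n\<close> factors \<open>\<delta>\<close> as a Chebyshev polynomial \<open>q(\<gamma>)\<close> with simple real
  roots times \<open>z d(\<gamma>) - x y e(\<gamma>)\<close>.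

  Irreducibility of each piece comes from a double cover of a plane. A level set \<open>\<gamma> = c\<close> is the
  cover \<open>(2z - xy)\<^sup>2 = (x\<^sup>2 - 4)(y\<^sup>2 - 4) + 4c - 8\<close> of the \<open>(x, y)\<close>-plane. On the last surface, \<open>t = \<gamma>\<close>
  and \<open>z = xy e(t)/d(t)\<close> turn the definition of \<open>\<gamma>\<close> into
  \<open>x\<^sup>2 (d\<^sup>2 - e(d - e)y\<^sup>2) = d\<^sup>2 (t + 2 - y\<^sup>2)\<close>, a double cover of the \<open>(t, y)\<close>-plane. Neither right-hand
  side is a square, as an order of vanishing is odd; in the second case this rests on
  \<open>d\<^sup>2 - (t + 2) e (d - e)\<close> being \<open>1\<close> or \<open>2 - t\<close>.
\<close>

section \<open>Algebraic sets and double covers of the plane\<close>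

definition eval2 :: "complex poly poly \<Rightarrow> complex \<Rightarrow> complex \<Rightarrow> complex" where
  "eval2 P u v = poly (poly P [:u:]) v"

lemma eval2_simps [simp]:
  "eval2 0 u v = 0" "eval2 1 u v = 1"
  "eval2 (P + Q) u v = eval2 P u v + eval2 Q u v"
  "eval2 (P - Q) u v = eval2 P u v - eval2 Q u v"
  "eval2 (- P) u v = - eval2 P u v"
  "eval2 (P * Q) u v = eval2 P u v * eval2 Q u v"
  "eval2 (P ^ k) u v = eval2 P u v ^ k"
  "eval2 [:p:] u v = poly p v"
  "eval2 (pCons p P) u v = poly p v + u * eval2 P u v"
  by (simp_all add: eval2_def)

text \<open>For each constant u the polynomial \<open>poly P [:u:]\<close> in v vanishes everywhere,
  hence is 0. So P has infinitely many roots in the domain of polynomials in v, namely the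
  constants.\<close>

lemma eval2_eq_0_imp:
  assumes "\<And>u v. eval2 P u v = 0"
  shows "P = 0"
proof (rule ccontr)
  assume "P \<noteq> 0"
  then have "finite {p. poly P p = 0}" by (rule poly_roots_finite)
  moreover have "range (\<lambda>u. [:u:]) \<subseteq> {p. poly P p = 0}"
  proof -
    have "poly P [:u:] = 0" for u
      using assms[of u] unfolding eval2_def by (simp flip: poly_all_0_iff_0)
    then show ?thesis by auto
  qed
  ultimately have "finite (range (\<lambda>u::complex. [:u:]))" by (rule finite_subset[rotated])
  moreover have "inj (\<lambda>u::complex. [:u:])" by (auto intro: injI)
  ultimately have "finite (UNIV :: complex set)" by (rule finite_imageD)
  then show False by (simp add: infinite_UNIV_char_0)
qed

lemma eval3_simps [simp]:
  "eval3 0 p = 0" "eval3 1 p = 1"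
  "eval3 (P + Q) p = eval3 P p + eval3 Q p"
  "eval3 (P - Q) p = eval3 P p - eval3 Q p"
  "eval3 (P * Q) p = eval3 P p * eval3 Q p"
  by (simp_all add: eval3_def split: prod.split)

lemma eval3_pCons: "eval3 (pCons P Q) (x, y, z) = eval2 P y z + x * eval3 Q (x, y, z)"
  by (simp add: eval3_def eval2_def)

lemma eval3_power [simp]: "eval3 (P ^ k) p = eval3 P p ^ k"
  by (induction k) simp_all

lemma eval3_const [simp]: "eval3 [:[:[:c:]:]:] p = c"
  and eval3_fst: "eval3 [:0, 1:] p = fst p"
  and eval3_snd: "eval3 [:[:0, 1:]:] p = fst (snd p)"
  and eval3_thd: "eval3 [:[:[:0, 1:]:]:] p = snd (snd p)"
  by (simp_all add: eval3_def split: prod.split)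

text \<open>Being polynomial becomes a closure property of functions, derived by introduction rules
  instead of by writing out nested coefficient lists.\<close>

definition polyfun2 :: "(complex \<Rightarrow> complex \<Rightarrow> complex) \<Rightarrow> bool" where
  "polyfun2 f \<longleftrightarrow> (\<exists>P. \<forall>u v. eval2 P u v = f u v)"

definition polyfun3 :: "(complex \<times> complex \<times> complex \<Rightarrow> complex) \<Rightarrow> bool" where
  "polyfun3 f \<longleftrightarrow> (\<exists>P. \<forall>p. eval3 P p = f p)"

lemma polyfun2_intros:
  "polyfun2 (\<lambda>u v. c)" "polyfun2 (\<lambda>u v. u)" "polyfun2 (\<lambda>u v. v)"
  "polyfun2 f \<Longrightarrow> polyfun2 h \<Longrightarrow> polyfun2 (\<lambda>u v. f u v + h u v)"
  "polyfun2 f \<Longrightarrow> polyfun2 h \<Longrightarrow> polyfun2 (\<lambda>u v. f u v - h u v)"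
  "polyfun2 f \<Longrightarrow> polyfun2 h \<Longrightarrow> polyfun2 (\<lambda>u v. f u v * h u v)"
  "polyfun2 f \<Longrightarrow> polyfun2 (\<lambda>u v. f u v ^ k)"
proof -
  show "polyfun2 (\<lambda>u v. c)" unfolding polyfun2_def by (intro exI[of _ "[:[:c:]:]"]) simp
  show "polyfun2 (\<lambda>u v. u)" unfolding polyfun2_def by (intro exI[of _ "[:0, 1:]"]) simp
  show "polyfun2 (\<lambda>u v. v)" unfolding polyfun2_def by (intro exI[of _ "[:[:0, 1:]:]"]) simp
next
  assume "polyfun2 f"
  then obtain P where P: "\<And>u v. eval2 P u v = f u v" by (auto simp: polyfun2_def)
  show "polyfun2 (\<lambda>u v. f u v ^ k)" unfolding polyfun2_def by (intro exI[of _ "P ^ k"]) (simp add: P)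
  assume "polyfun2 h"
  then obtain Q where Q: "\<And>u v. eval2 Q u v = h u v" by (auto simp: polyfun2_def)
  show "polyfun2 (\<lambda>u v. f u v + h u v)" unfolding polyfun2_def by (intro exI[of _ "P + Q"]) (simp add: P Q)
  show "polyfun2 (\<lambda>u v. f u v - h u v)" unfolding polyfun2_def by (intro exI[of _ "P - Q"]) (simp add: P Q)
  show "polyfun2 (\<lambda>u v. f u v * h u v)" unfolding polyfun2_def by (intro exI[of _ "P * Q"]) (simp add: P Q)
qed

lemma polyfun2_poly: "polyfun2 f \<Longrightarrow> polyfun2 (\<lambda>u v. poly p (f u v))"
  by (induction p) (auto intro!: polyfun2_intros)

lemma polyfun3_intros:
  "polyfun3 (\<lambda>p. c)" "polyfun3 (\<lambda>p. fst p)" "polyfun3 (\<lambda>p. fst (snd p))" "polyfun3 (\<lambda>p. snd (snd p))"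
  "polyfun3 f \<Longrightarrow> polyfun3 h \<Longrightarrow> polyfun3 (\<lambda>p. f p + h p)"
  "polyfun3 f \<Longrightarrow> polyfun3 h \<Longrightarrow> polyfun3 (\<lambda>p. f p - h p)"
  "polyfun3 f \<Longrightarrow> polyfun3 h \<Longrightarrow> polyfun3 (\<lambda>p. f p * h p)"
  "polyfun3 f \<Longrightarrow> polyfun3 (\<lambda>p. f p ^ k)"
proof -
  show "polyfun3 (\<lambda>p. c)" "polyfun3 (\<lambda>p. fst p)" "polyfun3 (\<lambda>p. fst (snd p))" "polyfun3 (\<lambda>p. snd (snd p))"
    unfolding polyfun3_def using eval3_const eval3_fst eval3_snd eval3_thd by blast+
next
  assume "polyfun3 f"
  then obtain P where P: "\<And>p. eval3 P p = f p" by (auto simp: polyfun3_def)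
  show "polyfun3 (\<lambda>p. f p ^ k)" unfolding polyfun3_def by (intro exI[of _ "P ^ k"]) (simp add: P)
  assume "polyfun3 h"
  then obtain Q where Q: "\<And>p. eval3 Q p = h p" by (auto simp: polyfun3_def)
  show "polyfun3 (\<lambda>p. f p + h p)" unfolding polyfun3_def by (intro exI[of _ "P + Q"]) (simp add: P Q)
  show "polyfun3 (\<lambda>p. f p - h p)" unfolding polyfun3_def by (intro exI[of _ "P - Q"]) (simp add: P Q)
  show "polyfun3 (\<lambda>p. f p * h p)" unfolding polyfun3_def by (intro exI[of _ "P * Q"]) (simp add: P Q)
qed

lemma polyfun3_poly: "polyfun3 f \<Longrightarrow> polyfun3 (\<lambda>p. poly q (f p))"
  by (induction q) (auto intro!: polyfun3_intros)

section \<open>Algebraic sets and irreducible components\<close>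

lemma algebraic_set_polyfun3:
  assumes "polyfun3 f"
  shows "algebraic_set {p. f p = 0}"
proof -
  obtain P where "\<And>p. eval3 P p = f p" using assms by (auto simp: polyfun3_def)
  then have "{p. f p = 0} = zero_locus {P}" by (auto simp: zero_locus_def)
  then show ?thesis unfolding algebraic_set_def by blast
qed

lemma algebraic_set_Int:
  assumes "algebraic_set V" "algebraic_set W"
  shows "algebraic_set (V \<inter> W)"
proof -
  obtain F G where "V = zero_locus F" "W = zero_locus G"
    using assms unfolding algebraic_set_def by blast
  then have "V \<inter> W = zero_locus (F \<union> G)" by (auto simp: zero_locus_def)
  then show ?thesis unfolding algebraic_set_def by blast
qed

lemma algebraic_set_Un:
  assumes "algebraic_set V" "algebraic_set W"
  shows "algebraic_set (V \<union> W)"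
proof -
  obtain F G where "V = zero_locus F" "W = zero_locus G"
    using assms unfolding algebraic_set_def by blast
  \<comment> \<open>At a point outside both loci some P in \<open>F\<close> and some Q in
    \<open>G\<close> are nonzero, and then so is their product.\<close>
  moreover have "zero_locus {P * Q | P Q. P \<in> F \<and> Q \<in> G} = zero_locus F \<union> zero_locus G"
  proof (intro equalityI subsetI)
    fix p assume p: "p \<in> zero_locus {P * Q | P Q. P \<in> F \<and> Q \<in> G}"
    have "eval3 P p * eval3 Q p = 0" if "P \<in> F" "Q \<in> G" for P Q
      using p that unfolding zero_locus_def mem_Collect_eq eval3_simps(5)[symmetric] by blast
    then show "p \<in> zero_locus F \<union> zero_locus G"
      unfolding zero_locus_def mult_eq_0_iff by blast
  next
    fix p assume "p \<in> zero_locus F \<union> zero_locus G"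
    then show "p \<in> zero_locus {P * Q | P Q. P \<in> F \<and> Q \<in> G}"
      by (auto simp: zero_locus_def)
  qed
  ultimately have "V \<union> W = zero_locus {P * Q | P Q. P \<in> F \<and> Q \<in> G}" by simp
  then show ?thesis unfolding algebraic_set_def by blast
qed

lemma algebraic_set_empty: "algebraic_set {}"
proof -
  have "{} = zero_locus {1}" by (auto simp: zero_locus_def)
  then show ?thesis unfolding algebraic_set_def by blast
qed

lemma algebraic_set_Union:
  assumes "finite \<C>" "\<And>C. C \<in> \<C> \<Longrightarrow> algebraic_set C"
  shows "algebraic_set (\<Union>\<C>)"
  using assms by (induction) (auto intro: algebraic_set_empty algebraic_set_Un)

lemma irreducible_imp_algebraic: "irreducible_algebraic_set V \<Longrightarrow> algebraic_set V"
  and irreducible_imp_nonempty: "irreducible_algebraic_set V \<Longrightarrow> V \<noteq> {}"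
  by (simp_all only: irreducible_algebraic_set_def not_False_eq_True)

lemma irreducible_UnD:
  assumes "irreducible_algebraic_set V" "algebraic_set A" "algebraic_set B" "V = A \<union> B"
  shows "V = A \<or> V = B"
  using assms(1)[unfolded irreducible_algebraic_set_def, THEN conjunct2, THEN conjunct2,
      rule_format, OF conjI[OF assms(2) conjI[OF assms(3,4)]]] .

text \<open>D is the union of its intersections with the newly inserted set and with the union of
  the others. Irreducibility selects one of the two, and the induction hypothesis treats the
  second.\<close>

lemma irreducible_subset_Union:
  assumes "finite \<C>" "\<And>C. C \<in> \<C> \<Longrightarrow> algebraic_set C"
    and "irreducible_algebraic_set D" "D \<subseteq> \<Union>\<C>"
  shows "\<exists>C\<in>\<C>. D \<subseteq> C"
  using assms
proof (induction rule: finite_induct)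
  case empty
  then show ?case using irreducible_imp_nonempty by blast
next
  case (insert C \<C>)
  have D: "algebraic_set D" using insert.prems(2) by (rule irreducible_imp_algebraic)
  have C: "algebraic_set C" and \<C>: "\<And>B. B \<in> \<C> \<Longrightarrow> algebraic_set B"
    using insert.prems(1) by simp_all
  have "algebraic_set (D \<inter> C)" "algebraic_set (D \<inter> \<Union>\<C>)"
    by (intro algebraic_set_Int algebraic_set_Union D C \<C> insert.hyps(1))+
  moreover have "D = (D \<inter> C) \<union> (D \<inter> \<Union>\<C>)" using insert.prems(3) by auto
  ultimately have "D = D \<inter> C \<or> D = D \<inter> \<Union>\<C>"
    by (rule irreducible_UnD[OF insert.prems(2)])
  then have "D \<subseteq> C \<or> D \<subseteq> \<Union>\<C>" by auto
  then show ?case using insert.IH[OF \<C> insert.prems(2)] by auto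
qed

lemma irreducible_components_iff:
  "C \<in> irreducible_components V \<longleftrightarrow> irreducible_algebraic_set C \<and> C \<subseteq> V \<and>
    (\<forall>D. irreducible_algebraic_set D \<longrightarrow> D \<subseteq> V \<longrightarrow> C \<subseteq> D \<longrightarrow> D = C)"
  unfolding irreducible_components_def by auto

text \<open>An irreducible subset of the union lies in a single member, so a maximal one is a
  member. Conversely \<open>anti\<close> makes every member maximal.\<close>

lemma irreducible_components_Union:
  assumes "finite \<C>" and irr: "\<And>C. C \<in> \<C> \<Longrightarrow> irreducible_algebraic_set C"
    and anti: "\<And>C D. C \<in> \<C> \<Longrightarrow> D \<in> \<C> \<Longrightarrow> C \<subseteq> D \<Longrightarrow> C = D"
  shows "irreducible_components (\<Union>\<C>) = \<C>"
proof -
  have sub: "\<exists>C\<in>\<C>. D \<subseteq> C" if "irreducible_algebraic_set D" "D \<subseteq> \<Union>\<C>" for D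
    by (rule irreducible_subset_Union[OF \<open>finite \<C>\<close> irreducible_imp_algebraic[OF irr] that])
  show ?thesis
  proof (intro equalityI subsetI)
    fix D assume "D \<in> irreducible_components (\<Union>\<C>)"
    then have D: "irreducible_algebraic_set D" "D \<subseteq> \<Union>\<C>"
      and max: "\<And>E. irreducible_algebraic_set E \<Longrightarrow> E \<subseteq> \<Union>\<C> \<Longrightarrow> D \<subseteq> E \<Longrightarrow> E = D"
      by (auto simp: irreducible_components_iff)
    obtain C where C: "C \<in> \<C>" "D \<subseteq> C" using sub D by blast
    then have "C = D" using max[OF irr[OF C(1)]] by blast
    then show "D \<in> \<C>" using C by simp
  next
    fix C assume C: "C \<in> \<C>"
    have "E = C" if E: "irreducible_algebraic_set E" "E \<subseteq> \<Union>\<C>" "C \<subseteq> E" for E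
    proof -
      obtain B where B: "B \<in> \<C>" "E \<subseteq> B" using sub E by blast
      then have "C = B" using anti C E by blast
      then show ?thesis using B E by blast
    qed
    moreover have "C \<subseteq> \<Union>\<C>" using C by blast
    ultimately show "C \<in> irreducible_components (\<Union>\<C>)"
      using irr[OF C] by (simp add: irreducible_components_iff)
  qed
qed

text \<open>
  On the double cover \<open>g w\<^sup>2 = M\<close> of the \<open>(u, v)\<close>-plane, \<open>cover_fun g M f\<close> says that \<open>f\<close> lies in
  \<open>R + R w\<close>, where \<open>R\<close> is the polynomial ring in \<open>u, v\<close> localised at \<open>g\<close>.
\<close>

definition cover_fun ::
    "complex poly poly \<Rightarrow> complex poly poly \<Rightarrow> (complex \<Rightarrow> complex \<Rightarrow> complex \<Rightarrow> complex) \<Rightarrow> bool" where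
  "cover_fun g M f \<longleftrightarrow> (\<exists>k \<alpha> \<beta>. \<forall>u v w. eval2 g u v \<noteq> 0 \<longrightarrow> eval2 g u v * w\<^sup>2 = eval2 M u v \<longrightarrow>
     eval2 g u v ^ k * f u v w = eval2 \<alpha> u v + eval2 \<beta> u v * w)"

lemma cover_fun_polyfun2:
  assumes "polyfun2 f"
  shows "cover_fun g M (\<lambda>u v w. f u v)"
proof -
  obtain P where "\<And>u v. eval2 P u v = f u v" using assms by (auto simp: polyfun2_def)
  then show ?thesis unfolding cover_fun_def
    by (intro exI[of _ 0] exI[of _ P]) simp
qed

lemma cover_fun_w: "cover_fun g M (\<lambda>u v w. w)"
  unfolding cover_fun_def by (intro exI[of _ 0] exI[of _ 1]) simp

lemma cover_fun_add:
  assumes "cover_fun g M f" "cover_fun g M h"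
  shows "cover_fun g M (\<lambda>u v w. f u v w + h u v w)"
proof -
  obtain k \<alpha> \<beta> l \<gamma> \<delta> where
    1: "\<And>u v w. eval2 g u v \<noteq> 0 \<Longrightarrow> eval2 g u v * w\<^sup>2 = eval2 M u v \<Longrightarrow>
      eval2 g u v ^ k * f u v w = eval2 \<alpha> u v + eval2 \<beta> u v * w" and
    2: "\<And>u v w. eval2 g u v \<noteq> 0 \<Longrightarrow> eval2 g u v * w\<^sup>2 = eval2 M u v \<Longrightarrow>
      eval2 g u v ^ l * h u v w = eval2 \<gamma> u v + eval2 \<delta> u v * w"
    using assms unfolding cover_fun_def by metis
  show ?thesis unfolding cover_fun_def
  proof (intro exI allI impI)
    fix u v w assume *: "eval2 g u v \<noteq> 0" "eval2 g u v * w\<^sup>2 = eval2 M u v"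
    have "eval2 g u v ^ (k + l) * (f u v w + h u v w) =
      eval2 g u v ^ l * (eval2 g u v ^ k * f u v w) + eval2 g u v ^ k * (eval2 g u v ^ l * h u v w)"
      by (simp add: power_add algebra_simps)
    then show "eval2 g u v ^ (k + l) * (f u v w + h u v w) =
       eval2 (g ^ l * \<alpha> + g ^ k * \<gamma>) u v + eval2 (g ^ l * \<beta> + g ^ k * \<delta>) u v * w"
      by (simp only: 1[OF *] 2[OF *]) (simp add: algebra_simps)
  qed
qed

lemma cover_fun_mult:
  assumes "cover_fun g M f" "cover_fun g M h"
  shows "cover_fun g M (\<lambda>u v w. f u v w * h u v w)"
proof -
  obtain k \<alpha> \<beta> l \<gamma> \<delta> where
    1: "\<And>u v w. eval2 g u v \<noteq> 0 \<Longrightarrow> eval2 g u v * w\<^sup>2 = eval2 M u v \<Longrightarrow>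
      eval2 g u v ^ k * f u v w = eval2 \<alpha> u v + eval2 \<beta> u v * w" and
    2: "\<And>u v w. eval2 g u v \<noteq> 0 \<Longrightarrow> eval2 g u v * w\<^sup>2 = eval2 M u v \<Longrightarrow>
      eval2 g u v ^ l * h u v w = eval2 \<gamma> u v + eval2 \<delta> u v * w"
    using assms unfolding cover_fun_def by metis
  show ?thesis unfolding cover_fun_def
  proof (intro exI allI impI)
    fix u v w assume *: "eval2 g u v \<noteq> 0" "eval2 g u v * w\<^sup>2 = eval2 M u v"
    \<comment> \<open>The extra factor g absorbs the square of w in the product: g w^2 is replaced
      by M.\<close>
    have "eval2 g u v ^ (k + l + 1) * (f u v w * h u v w) =
      eval2 g u v * (eval2 g u v ^ k * f u v w) * (eval2 g u v ^ l * h u v w)"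
      by (simp add: power_add algebra_simps)
    also have "\<dots> = eval2 g u v * eval2 \<alpha> u v * eval2 \<gamma> u v +
        eval2 \<beta> u v * eval2 \<delta> u v * (eval2 g u v * w\<^sup>2) +
        eval2 g u v * (eval2 \<alpha> u v * eval2 \<delta> u v + eval2 \<beta> u v * eval2 \<gamma> u v) * w"
      by (simp only: 1[OF *] 2[OF *]) (simp add: algebra_simps power2_eq_square)
    finally show "eval2 g u v ^ (k + l + 1) * (f u v w * h u v w) =
       eval2 (g * \<alpha> * \<gamma> + \<beta> * \<delta> * M) u v + eval2 (g * (\<alpha> * \<delta> + \<beta> * \<gamma>)) u v * w"
      by (simp add: *)
  qed
qed

lemma cover_fun_poly:
  assumes "cover_fun g M f"
  shows "cover_fun g M (\<lambda>u v w. poly p (f u v w))"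
  by (induction p) (auto intro!: cover_fun_add cover_fun_mult assms cover_fun_polyfun2 polyfun2_intros)

lemma cover_fun_eval2:
  assumes "cover_fun g M f" "cover_fun g M h"
  shows "cover_fun g M (\<lambda>u v w. eval2 P (f u v w) (h u v w))"
  by (induction P) (auto intro!: cover_fun_add cover_fun_mult cover_fun_poly assms cover_fun_polyfun2 polyfun2_intros)

lemma cover_fun_eval3:
  assumes "cover_fun g M x" "cover_fun g M y" "cover_fun g M z"
  shows "cover_fun g M (\<lambda>u v w. eval3 P (x u v w, y u v w, z u v w))"
  by (induction P) (auto simp: eval3_pCons intro!: cover_fun_add cover_fun_mult cover_fun_eval2
      assms cover_fun_polyfun2 polyfun2_intros)

section \<open>Irreducibility from a double cover\<close>

text \<open>By \<open>nonsquare\<close>, M/g is not the square of a rational function, so adjoining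
  w = sqrt(M/g) yields a field, without zero divisors. The proof carries this out on
  coefficients.\<close>

lemma double_cover_product_zero:
  fixes g M \<alpha>\<^sub>1 \<beta>\<^sub>1 \<alpha>\<^sub>2 \<beta>\<^sub>2 :: "complex poly poly"
  assumes g: "g \<noteq> 0"
    and nonsquare: "\<And>\<alpha> \<beta>. M * \<beta>\<^sup>2 = g * \<alpha>\<^sup>2 \<Longrightarrow> \<beta> = 0"
    and zero: "\<And>u v w. eval2 g u v \<noteq> 0 \<Longrightarrow> eval2 g u v * w\<^sup>2 = eval2 M u v \<Longrightarrow>
      (eval2 \<alpha>\<^sub>1 u v + eval2 \<beta>\<^sub>1 u v * w) * (eval2 \<alpha>\<^sub>2 u v + eval2 \<beta>\<^sub>2 u v * w) = 0"
  shows "\<alpha>\<^sub>1 = 0 \<and> \<beta>\<^sub>1 = 0 \<or> \<alpha>\<^sub>2 = 0 \<and> \<beta>\<^sub>2 = 0"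
proof -
  have M: "M \<noteq> 0" using nonsquare[of 1 0] by auto
  have *: "eval2 g u v * eval2 \<alpha>\<^sub>1 u v * eval2 \<alpha>\<^sub>2 u v + eval2 M u v * eval2 \<beta>\<^sub>1 u v * eval2 \<beta>\<^sub>2 u v = 0 \<and>
      eval2 M u v * (eval2 \<alpha>\<^sub>1 u v * eval2 \<beta>\<^sub>2 u v + eval2 \<beta>\<^sub>1 u v * eval2 \<alpha>\<^sub>2 u v) = 0"
    if "eval2 g u v \<noteq> 0" for u v
  proof -
    \<comment> \<open>Both w and -w lie over (u, v). The sum and the difference of the two vanishing
      products separate the parts that are even and odd in w; the factor M in the second identity
      allows for w = 0.\<close>
    define w where "w = csqrt (eval2 M u v / eval2 g u v)"
    have w: "eval2 g u v * w\<^sup>2 = eval2 M u v" using that by (simp add: w_def)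
    then have w': "eval2 g u v * (-w)\<^sup>2 = eval2 M u v" by simp
    show ?thesis using zero[OF that w] zero[OF that w'] w
      by algebra
  qed
  \<comment> \<open>A further factor g makes both identities hold also where g vanishes, so they
    become identities of polynomials.\<close>
  have "eval2 (g * (g * \<alpha>\<^sub>1 * \<alpha>\<^sub>2 + M * \<beta>\<^sub>1 * \<beta>\<^sub>2)) u v = 0"
    "eval2 (g * M * (\<alpha>\<^sub>1 * \<beta>\<^sub>2 + \<beta>\<^sub>1 * \<alpha>\<^sub>2)) u v = 0" for u v
    using *[of u v] by auto
  from this[THEN eval2_eq_0_imp]
  have 1: "g * \<alpha>\<^sub>1 * \<alpha>\<^sub>2 + M * \<beta>\<^sub>1 * \<beta>\<^sub>2 = 0" and 2: "\<alpha>\<^sub>1 * \<beta>\<^sub>2 + \<beta>\<^sub>1 * \<alpha>\<^sub>2 = 0"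
    using g M by auto
  have "\<beta>\<^sub>2 * (M * \<beta>\<^sub>1\<^sup>2 - g * \<alpha>\<^sub>1\<^sup>2) = 0" using 1 2 by algebra
  then have "\<beta>\<^sub>2 = 0 \<or> \<beta>\<^sub>1 = 0" using nonsquare[of \<beta>\<^sub>1 \<alpha>\<^sub>1] by auto
  then show ?thesis using 1 2 g nonsquare[of \<beta>\<^sub>1 0] by auto
qed

text \<open>If V were the union of two proper algebraic subsets, two polynomials, neither zero on V,
  would have product zero on V. After pulling back along the parametrisation \<open>into\<close>,
  one of them is zero on the cover, and \<open>dense\<close> carries this back to V.\<close>

lemma irreducible_double_cover:
  fixes x y z :: "complex \<Rightarrow> complex \<Rightarrow> complex \<Rightarrow> complex"
  assumes V: "algebraic_set V" "V \<noteq> {}"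
    and g: "g \<noteq> 0"
    and nonsquare: "\<And>\<alpha> \<beta>. M * \<beta>\<^sup>2 = g * \<alpha>\<^sup>2 \<Longrightarrow> \<beta> = 0"
    and "cover_fun g M x" "cover_fun g M y" "cover_fun g M z"
    and into: "\<And>u v w. eval2 g u v \<noteq> 0 \<Longrightarrow> eval2 g u v * w\<^sup>2 = eval2 M u v \<Longrightarrow>
      (x u v w, y u v w, z u v w) \<in> V"
    and dense: "\<And>P p. p \<in> V \<Longrightarrow> (\<And>u v w. eval2 g u v \<noteq> 0 \<Longrightarrow> eval2 g u v * w\<^sup>2 = eval2 M u v \<Longrightarrow>
      eval3 P (x u v w, y u v w, z u v w) = 0) \<Longrightarrow> eval3 P p = 0"
  shows "irreducible_algebraic_set V"
  unfolding irreducible_algebraic_set_def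
proof (intro conjI V allI impI)
  fix V1 V2
  assume "algebraic_set V1 \<and> algebraic_set V2 \<and> V = V1 \<union> V2"
  then obtain F1 F2 where V1: "V1 = zero_locus F1" and V2: "V2 = zero_locus F2" and Vu: "V = V1 \<union> V2"
    by (auto simp: algebraic_set_def)
  show "V = V1 \<or> V = V2"
  proof (rule ccontr)
    assume "\<not> (V = V1 \<or> V = V2)"
    then obtain p1 p2 where "p1 \<in> V" "p1 \<notin> V1" "p2 \<in> V" "p2 \<notin> V2" using Vu by blast
    then obtain Q1 Q2 where Q1: "Q1 \<in> F1" "eval3 Q1 p1 \<noteq> 0" and Q2: "Q2 \<in> F2" "eval3 Q2 p2 \<noteq> 0"
      using V1 V2 by (auto simp: zero_locus_def)
    have Q0: "eval3 Q1 p * eval3 Q2 p = 0" if "p \<in> V" for p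
      using that Q1(1) Q2(1) Vu V1 V2 by (auto simp: zero_locus_def)
    have "cover_fun g M (\<lambda>u v w. eval3 Q1 (x u v w, y u v w, z u v w))"
      "cover_fun g M (\<lambda>u v w. eval3 Q2 (x u v w, y u v w, z u v w))"
      by (intro cover_fun_eval3 assms)+
    then obtain k \<alpha> \<beta> l \<gamma> \<delta> where
      1: "\<And>u v w. eval2 g u v \<noteq> 0 \<Longrightarrow> eval2 g u v * w\<^sup>2 = eval2 M u v \<Longrightarrow>
        eval2 g u v ^ k * eval3 Q1 (x u v w, y u v w, z u v w) = eval2 \<alpha> u v + eval2 \<beta> u v * w" and
      2: "\<And>u v w. eval2 g u v \<noteq> 0 \<Longrightarrow> eval2 g u v * w\<^sup>2 = eval2 M u v \<Longrightarrow>
        eval2 g u v ^ l * eval3 Q2 (x u v w, y u v w, z u v w) = eval2 \<gamma> u v + eval2 \<delta> u v * w"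
      unfolding cover_fun_def by metis
    have "\<alpha> = 0 \<and> \<beta> = 0 \<or> \<gamma> = 0 \<and> \<delta> = 0"
    proof (rule double_cover_product_zero[OF g nonsquare])
      fix u v w assume *: "eval2 g u v \<noteq> 0" "eval2 g u v * w\<^sup>2 = eval2 M u v"
      show "(eval2 \<alpha> u v + eval2 \<beta> u v * w) * (eval2 \<gamma> u v + eval2 \<delta> u v * w) = 0"
        unfolding 1[OF *, symmetric] 2[OF *, symmetric] using Q0[OF into[OF *]] by auto
    qed
    then show False
    proof
      assume "\<alpha> = 0 \<and> \<beta> = 0"
      then have "eval3 Q1 p1 = 0" using 1 by (intro dense[OF \<open>p1 \<in> V\<close>]) auto
      then show False using Q1 by simp
    next
      assume "\<gamma> = 0 \<and> \<delta> = 0"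
      then have "eval3 Q2 p2 = 0" using 2 by (intro dense[OF \<open>p2 \<in> V\<close>]) auto
      then show False using Q2 by simp
    qed
  qed
qed

section \<open>Irreducible surfaces\<close>

text \<open>The modulus of p at \<open>z\<^sub>0\<close> is that of the leading coefficient times
  the product of the distances to the roots. If all distances were at least \<epsilon>, it would not
  be this small.\<close>

lemma poly_root_near:
  fixes p :: "complex poly"
  assumes "cmod (poly p z\<^sub>0) < cmod (lead_coeff p) * \<epsilon> ^ degree p" "\<epsilon> > 0"
  shows "\<exists>z. poly p z = 0 \<and> cmod (z\<^sub>0 - z) < \<epsilon>"
proof (rule ccontr)
  assume far: "\<nexists>z. poly p z = 0 \<and> cmod (z\<^sub>0 - z) < \<epsilon>"
  obtain root where p: "smult (lead_coeff p) (\<Prod>i<degree p. [:- root i, 1:]) = p"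
    using complex_poly_decompose' by blast
  have *: "poly p z = lead_coeff p * (\<Prod>i<degree p. z - root i)" for z
    by (subst p[symmetric]) (simp add: poly_prod)
  have "poly p (root i) = 0" if "i < degree p" for i
    using that by (auto simp: *)
  then have "\<epsilon> \<le> cmod (z\<^sub>0 - root i)" if "i < degree p" for i
    using that far by force
  then have "(\<Prod>i<degree p. \<epsilon>) \<le> (\<Prod>i<degree p. cmod (z\<^sub>0 - root i))"
    using \<open>\<epsilon> > 0\<close> by (intro prod_mono) auto
  then have "cmod (lead_coeff p) * \<epsilon> ^ degree p \<le> cmod (poly p z\<^sub>0)"
    by (simp add: * norm_mult prod_norm[symmetric] mult_left_mono)
  then show False using assms(1) by simp
qed

lemma continuous_on_eval2 [continuous_intros]:
  assumes "continuous_on S f" "continuous_on S h"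
  shows "continuous_on S (\<lambda>s. eval2 P (f s) (h s))"
  by (induction P) (auto intro!: continuous_intros assms)

lemma continuous_on_eval3: "continuous_on S (eval3 P)"
proof (induction P)
  case (pCons Q P)
  have "eval3 (pCons Q P) = (\<lambda>p. eval2 Q (fst (snd p)) (snd (snd p)) + fst p * eval3 P p)"
    by (auto simp: eval3_pCons)
  then show ?case using pCons by (simp del: split_paired_All) (intro continuous_intros)
qed (simp add: continuous_on_const)

lemma eval2_line: "\<exists>p. \<forall>s. poly p s = eval2 P (a + s * b) (c + s * d)"
proof (induction P)
  case (pCons q P)
  then obtain p where "\<And>s. poly p s = eval2 P (a + s * b) (c + s * d)" by blast
  then show ?case
    by (intro exI[of _ "pcompose q [:c, d:] + [:a, b:] * p"]) (simp add: poly_pcompose algebra_simps)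
qed (auto intro: exI[of _ 0])

lemma dist_Pair_le: "dist (a, b) (c, d) \<le> dist a c + dist b d"
  by (simp add: dist_Pair_Pair sqrt_sum_squares_le_sum)

text \<open>
  The roots of a polynomial with constant leading coefficient depend continuously on its coefficients,
  so the part of the surface over a dense set of \<open>(x, y)\<close> is dense in it.
\<close>

lemma surface_dense:
  fixes P :: "complex \<Rightarrow> complex \<Rightarrow> complex poly"
  assumes degree: "\<And>x y. degree (P x y) = N" and lead: "\<And>x y. lead_coeff (P x y) = c" and "c \<noteq> 0"
    and cont: "\<And>z. polyfun2 (\<lambda>x y. poly (P x y) z)"
    and "h \<noteq> 0"
    and zero: "\<And>x y z. poly (P x y) z = 0 \<Longrightarrow> eval2 h x y \<noteq> 0 \<Longrightarrow> eval3 Q (x, y, z) = 0"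
    and z: "poly (P x y) z = 0"
  shows "eval3 Q (x, y, z) = 0"
proof (rule ccontr)
  assume nz: "eval3 Q (x, y, z) \<noteq> 0"
  obtain x' y' where xy': "eval2 h x' y' \<noteq> 0" using eval2_eq_0_imp \<open>h \<noteq> 0\<close> by blast
  \<comment> \<open>The line through (x, y) at s = 0 and a point with h nonzero at s = 1. Along it h
    is a nonzero polynomial in s, so h does not vanish for small nonzero s.\<close>
  define X Y where "X s = x + s * (x' - x)" and "Y s = y + s * (y' - y)" for s
  obtain p where p: "\<And>s. poly p s = eval2 h (X s) (Y s)" using eval2_line unfolding X_def Y_def by blast
  have "poly p 1 \<noteq> 0" using xy' by (simp add: p X_def Y_def)
  then have "finite {s. poly p s = 0}" by (intro poly_roots_finite) auto
  then have "\<forall>\<^sub>F s in at 0. s \<notin> {s. poly p s = 0}"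
    using islimpt_finite[of "{s. poly p s = 0}" 0] by (simp only: islimpt_iff_eventually not_not)
  then have good: "\<forall>\<^sub>F s in at 0. eval2 h (X s) (Y s) \<noteq> 0" by (simp add: p)
  have "open {p. eval3 Q p \<noteq> 0}"
    by (rule open_Collect_neq) (auto intro: continuous_on_eval3)
  then obtain \<epsilon> where \<epsilon>: "\<epsilon> > 0" "\<And>p. dist p (x, y, z) < \<epsilon> \<Longrightarrow> eval3 Q p \<noteq> 0"
    unfolding open_dist using nz by blast
  obtain R where R: "\<And>x y. eval2 R x y = poly (P x y) z" using cont[of z] by (auto simp: polyfun2_def)
  have XY: "continuous_on UNIV X" "continuous_on UNIV Y"
    unfolding X_def Y_def by (intro continuous_intros)+
  then have "continuous_on UNIV (\<lambda>s. eval2 R (X s) (Y s))" by (intro continuous_intros)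
  then have "((\<lambda>s. eval2 R (X s) (Y s)) \<longlongrightarrow> eval2 R (X 0) (Y 0)) (at 0)"
    by (auto simp: continuous_on_def)
  then have "((\<lambda>s. poly (P (X s) (Y s)) z) \<longlongrightarrow> 0) (at 0)"
    using z by (simp add: R X_def Y_def)
  moreover have "cmod c * (\<epsilon>/2) ^ N > 0" using \<open>c \<noteq> 0\<close> \<epsilon>(1) by simp
  \<comment> \<open>The value at the fixed z tends to 0 with s while degree and leading coefficient
    stay the same, so \<open>poly_root_near\<close> applies with radius \<epsilon>/2.\<close>
  ultimately have small: "\<forall>\<^sub>F s in at 0. cmod (poly (P (X s) (Y s)) z) < cmod c * (\<epsilon>/2) ^ N"
    unfolding tendsto_iff dist_norm by simp
  have "\<forall>\<^sub>F s in at 0. dist (X s) x < \<epsilon>/4" "\<forall>\<^sub>F s in at 0. dist (Y s) y < \<epsilon>/4"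
  proof -
    have lim: "(X \<longlongrightarrow> X 0) (at 0)" "(Y \<longlongrightarrow> Y 0) (at 0)"
      using XY by (simp_all add: continuous_on_def)
    have "0 < \<epsilon>/4" using \<epsilon>(1) by simp
    then have "\<forall>\<^sub>F s in at 0. dist (X s) (X 0) < \<epsilon>/4" "\<forall>\<^sub>F s in at 0. dist (Y s) (Y 0) < \<epsilon>/4"
      by (rule tendstoD[OF lim(1)], rule tendstoD[OF lim(2)])
    moreover have "X 0 = x" "Y 0 = y" by (simp_all add: X_def Y_def)
    ultimately show "\<forall>\<^sub>F s in at 0. dist (X s) x < \<epsilon>/4" "\<forall>\<^sub>F s in at 0. dist (Y s) y < \<epsilon>/4"
      by simp_all
  qed
  with good small have "\<forall>\<^sub>F s in at (0::complex). False"
  proof eventually_elim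
    case (elim s)
    have "cmod (poly (P (X s) (Y s)) z) <
        cmod (lead_coeff (P (X s) (Y s))) * (\<epsilon>/2) ^ degree (P (X s) (Y s))"
      unfolding lead unfolding degree by (fact elim(2))
    from poly_root_near[OF this] \<epsilon>(1)
    obtain z' where z': "poly (P (X s) (Y s)) z' = 0" "cmod (z - z') < \<epsilon>/2"
      by auto
    have "dist (X s, Y s, z') (x, y, z) \<le> dist (X s) x + dist (Y s, z') (y, z)"
      by (rule dist_Pair_le)
    also have "dist (Y s, z') (y, z) \<le> dist (Y s) y + dist z' z"
      by (rule dist_Pair_le)
    also have "dist (X s) x + (dist (Y s) y + dist z' z) < \<epsilon>"
      using elim z'(2) by (simp add: dist_norm norm_minus_commute)
    finally have "dist (X s, Y s, z') (x, y, z) < \<epsilon>" by simp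
    then show False using \<epsilon>(2) zero[OF z'(1) elim(1)] by blast
  qed
  then show False by simp
qed

section \<open>The level sets and the remaining surface\<close>

text \<open>A square has even order at a, so the orders of the two sides would differ in parity.
  Over a general domain, this covers coefficients that are polynomials in v.\<close>

lemma odd_order_nonsquare:
  fixes p q \<alpha> \<beta> :: "'a::idom poly"
  assumes "p * \<beta>\<^sup>2 = q * \<alpha>\<^sup>2" "p \<noteq> 0" "q \<noteq> 0"
    and "odd (Polynomial.order a p + Polynomial.order a q)"
  shows "\<beta> = 0"
proof (rule ccontr)
  assume "\<beta> \<noteq> 0"
  then have "\<alpha> \<noteq> 0" using assms by auto
  have "Polynomial.order a (r * \<gamma>\<^sup>2) = Polynomial.order a r + 2 * Polynomial.order a \<gamma>"
    if "r \<noteq> 0" "\<gamma> \<noteq> 0" for r \<gamma> :: "'a poly"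
    using that by (simp add: power2_eq_square order_mult)
  from this[of p \<beta>] this[of q \<alpha>] have "Polynomial.order a p + 2 * Polynomial.order a \<beta> =
      Polynomial.order a q + 2 * Polynomial.order a \<alpha>"
    using assms(1-3) \<open>\<alpha> \<noteq> 0\<close> \<open>\<beta> \<noteq> 0\<close> by simp
  then show False using assms(4) by presburger
qed

lemma polyfun3_gamma_xyz: "polyfun3 (\<lambda>p. gamma_xyz (fst p) (fst (snd p)) (snd (snd p)))"
  unfolding gamma_xyz_def by (intro polyfun3_intros)

text \<open>The parameters are u = y, v = x and w = 2z - xy. \<open>M\<close> is (x^2 - 4)(y^2 - 4)
  + 4c - 8 written as a polynomial in y, with leading coefficient x^2 - 4.\<close>

lemma irreducible_gamma_level: "irreducible_algebraic_set {(x, y, z). gamma_xyz x y z = c}"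
proof (rule irreducible_double_cover[where g = 1 and x = "\<lambda>u v w. v" and y = "\<lambda>u v w. u"
      and z = "\<lambda>u v w. u * v * (1/2) + w * (1/2)"
      and M = "[:[:4 * (2 + c), 0, -4:], 0, [:-4, 0, 1:]:]"])
  let ?M = "[:[:4 * (2 + c), 0, -4:], 0, [:-4, 0, 1:]:]"
  have "{(x, y, z). gamma_xyz x y z = c} = {p. gamma_xyz (fst p) (fst (snd p)) (snd (snd p)) - c = 0}"
    by auto
  then show "algebraic_set {(x, y, z). gamma_xyz x y z = c}"
    by (simp only:) (intro algebraic_set_polyfun3 polyfun3_intros polyfun3_gamma_xyz)
  have "gamma_xyz (csqrt (c + 2)) 0 0 = c" by (simp add: gamma_xyz_def)
  then show "{(x, y, z). gamma_xyz x y z = c} \<noteq> {}" by blast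
  show "\<beta> = 0" if "?M * \<beta>\<^sup>2 = 1 * \<alpha>\<^sup>2" for \<alpha> \<beta>
  proof -
    \<comment> \<open>Comparing leading coefficients in u reduces the claim to v^2 - 4, which has
      order exactly 1 at v = 2.\<close>
    have "lead_coeff (?M * \<beta>\<^sup>2) = lead_coeff (\<alpha>\<^sup>2)" using that by simp
    then have "[:-4, 0, 1:] * (lead_coeff \<beta>)\<^sup>2 = 1 * (lead_coeff \<alpha>)\<^sup>2"
      by (simp only: lead_coeff_mult lead_coeff_power) simp
    moreover have "[:-4, 0, 1:] = [:-2, 1:] * [:2, 1::complex:]" by simp
    then have "Polynomial.order 2 [:-4, 0, 1::complex:] = Polynomial.order 2 [:-2, 1::complex:] + Polynomial.order 2 [:2, 1::complex:]"
      by (metis mult_eq_0_iff order_mult pCons_eq_0_iff one_neq_zero)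
    then have "Polynomial.order 2 [:-4, 0, 1::complex:] = 1"
      using order_power_n_n[of "2::complex" 1] by (simp add: order_0I)
    ultimately have "lead_coeff \<beta> = 0"
      
      by (intro odd_order_nonsquare[where a = 2 and p = "[:-4, 0, 1:]" and q = 1]) auto
    then show ?thesis by simp
  qed
  show "cover_fun 1 ?M (\<lambda>u v w. u * v * (1/2) + w * (1/2))"
    by (intro cover_fun_add cover_fun_mult cover_fun_w cover_fun_polyfun2 polyfun2_intros)
  fix u v w :: complex assume "eval2 1 u v * w\<^sup>2 = eval2 ?M u v"
  then have "w\<^sup>2 = 4 * (2 + c) - 4 * v\<^sup>2 + u\<^sup>2 * (v\<^sup>2 - 4)"
    by (simp add: algebra_simps power2_eq_square)
  then have "4 * gamma_xyz v u (u * v * (1/2) + w * (1/2)) = 4 * c"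
    by (simp add: gamma_xyz_def power2_eq_square algebra_simps)
  then show "(v, u, u * v * (1/2) + w * (1/2)) \<in> {(x, y, z). gamma_xyz x y z = c}" by simp
next
  let ?M = "[:[:4 * (2 + c), 0, -4:], 0, [:-4, 0, 1:]:]"
  fix P p assume "p \<in> {(x, y, z). gamma_xyz x y z = c}"
    and zero: "\<And>u v w. eval2 1 u v \<noteq> 0 \<Longrightarrow> eval2 1 u v * w\<^sup>2 = eval2 ?M u v \<Longrightarrow>
      eval3 P (v, u, u * v * (1/2) + w * (1/2)) = 0"
  then obtain x y z where p: "p = (x, y, z)" "gamma_xyz x y z = c" by auto
  have "eval2 1 y x * (2 * z - x * y)\<^sup>2 = eval2 ?M y x"
    by (simp add: p(2)[symmetric] gamma_xyz_def power2_eq_square algebra_simps)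
  moreover have "y * x * (1/2) + (2 * z - x * y) * (1/2) = z" by (simp add: field_simps)
  ultimately show "eval3 P p = 0" using zero[of y x "2 * z - x * y"] by (simp only: p(1)) simp
qed (auto intro!: cover_fun_polyfun2 polyfun2_intros)

text \<open>The parameters are v = y, w = x and u = t + 2 - y^2 with t = \<gamma>, so
  \<open>T u v\<close> recovers t. The shift moves the locus where the order is odd to u =
  0.\<close>

lemma irreducible_two_bridge_surface:
  fixes d e r :: "complex poly"
  defines "V \<equiv> {(x, y, z). z * poly d (gamma_xyz x y z) = x * y * poly e (gamma_xyz x y z)}"
  assumes deg: "d \<noteq> 0" "e = 0 \<or> degree e < degree d"
    and "r \<noteq> 0" and r: "d\<^sup>2 - [:2, 1:] * e * (d - e) = r"
    and coprime: "\<And>t. poly d t = 0 \<Longrightarrow> poly e t \<noteq> 0"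
  shows "irreducible_algebraic_set V"
proof -
  define T where "T u v = u + v\<^sup>2 - 2" for u v :: complex
  have T: "polyfun2 T" unfolding T_def by (intro polyfun2_intros)
  let ?E = "\<lambda>t v. (poly d t)\<^sup>2 - poly e t * (poly d t - poly e t) * v\<^sup>2"
  obtain d' where d': "\<And>u v. eval2 d' u v = poly d (T u v)"
    using polyfun2_poly[OF T, of d] by (auto simp: polyfun2_def)
  have "polyfun2 (\<lambda>u v. ?E (T u v) v)"
    by (intro polyfun2_intros polyfun2_poly T)
  then obtain D where D: "\<And>u v. eval2 D u v = ?E (T u v) v" by (auto simp: polyfun2_def)
  have r': "(poly d t)\<^sup>2 - (2 + t) * poly e t * (poly d t - poly e t) = poly r t" for t
    by (simp flip: r add: algebra_simps)
  \<comment> \<open>The equation of the cover is E w^2 = u d^2, with E for \<open>?E\<close>. Both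
    sides are multiplied by d so that g is nonzero exactly where d and E are.\<close>
  define g where "g = d' * D"
  define M where "M = [:0, 1:] * d' ^ 3"
  have eval_g: "eval2 g u v = poly d (T u v) * ?E (T u v) v" for u v by (simp add: g_def d' D)
  have eval_M: "eval2 M u v = u * poly d (T u v) ^ 3" for u v by (simp add: M_def d')
  obtain t where t: "poly r t \<noteq> 0" using \<open>r \<noteq> 0\<close> poly_all_0_iff_0 by blast
  \<comment> \<open>On u = 0 one has v^2 = t + 2, and E becomes r(t) there. Hence \<open>D\<close>
    is not identically zero on u = 0 and has order 0.\<close>
  have D0: "eval2 D 0 (csqrt (t + 2)) \<noteq> 0"
    using t by (simp add: D T_def r'[symmetric] algebra_simps)
  then have "poly D 0 \<noteq> 0" by (auto simp: eval2_def)
  then have ord_D: "Polynomial.order 0 D = 0" "D \<noteq> 0" by (auto simp: order_0I)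
  obtain s where "poly d s \<noteq> 0" using \<open>d \<noteq> 0\<close> poly_all_0_iff_0 by blast
  then have "eval2 d' (s + 2) 0 \<noteq> 0" by (simp add: d' T_def)
  then have "d' \<noteq> 0" by auto
  show ?thesis
  proof (rule irreducible_double_cover[where g = g and M = M and x = "\<lambda>u v w. w" and y = "\<lambda>u v w. v"
        and z = "\<lambda>u v w. w * v * poly e (T u v) / poly d (T u v)"])
    have "V = {p. snd (snd p) * poly d (gamma_xyz (fst p) (fst (snd p)) (snd (snd p))) -
        fst p * fst (snd p) * poly e (gamma_xyz (fst p) (fst (snd p)) (snd (snd p))) = 0}"
      by (auto simp: V_def)
    then show "algebraic_set V"
      by (simp only:) (intro algebraic_set_polyfun3 polyfun3_intros polyfun3_poly polyfun3_gamma_xyz)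
    have "(0, 0, 0) \<in> V" by (simp add: V_def)
    then show "V \<noteq> {}" by blast
    show g0: "g \<noteq> 0" using \<open>d' \<noteq> 0\<close> ord_D by (simp add: g_def)
    show "\<beta> = 0" if "M * \<beta>\<^sup>2 = g * \<alpha>\<^sup>2" for \<alpha> \<beta>
    proof (rule odd_order_nonsquare[OF that _ g0, where a = 0])
      show M0: "M \<noteq> 0" using \<open>d' \<noteq> 0\<close> by (simp add: M_def)
      \<comment> \<open>With o the order of \<open>d'\<close> at u = 0, the orders of M and g are 1
        + 3o and o, of odd sum.\<close>
      have "Polynomial.order 0 M = 1 + 3 * Polynomial.order 0 d'"
        using \<open>d' \<noteq> 0\<close> order_power_n_n[of "0 :: complex poly" 1] unfolding M_def power3_eq_cube
        by (subst order_mult; simp add: order_mult)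
      moreover have "Polynomial.order 0 g = Polynomial.order 0 d'"
        using g0 ord_D unfolding g_def by (simp add: order_mult)
      ultimately show "odd (Polynomial.order 0 M + Polynomial.order 0 g)" by simp
    qed
    show "cover_fun g M (\<lambda>u v w. w * v * poly e (T u v) / poly d (T u v))"
    proof -
      have "polyfun2 (\<lambda>u v. v * poly e (T u v) * ?E (T u v) v)"
        by (intro polyfun2_intros polyfun2_poly T)
      then obtain B where B: "\<And>u v. eval2 B u v = v * poly e (T u v) * ?E (T u v) v"
        by (auto simp: polyfun2_def)
      show ?thesis unfolding cover_fun_def
        by (intro exI[of _ 1] exI[of _ 0] exI[of _ B]) (simp add: B eval_g)
    qed
  next
    fix u v w assume "eval2 g u v \<noteq> 0" and w: "eval2 g u v * w\<^sup>2 = eval2 M u v"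
    define t where "t = T u v"
    have nz: "poly d t \<noteq> 0" "?E t v \<noteq> 0"
      using \<open>eval2 g u v \<noteq> 0\<close> by (simp_all add: eval_g t_def)
    have w2: "w\<^sup>2 * ?E t v = u * (poly d t)\<^sup>2"
      using w nz unfolding eval_g eval_M t_def[symmetric] by (simp add: power2_eq_square power3_eq_cube mult_ac)
    have "gamma_xyz w v (w * v * poly e t / poly d t) = w\<^sup>2 * ?E t v / (poly d t)\<^sup>2 + v\<^sup>2 - 2"
      using nz by (simp add: gamma_xyz_def field_simps power2_eq_square)
    also have "\<dots> = t" unfolding w2 using nz(1) by (simp add: t_def T_def)
    finally show "(w, v, w * v * poly e (T u v) / poly d (T u v)) \<in> V"
      using nz by (simp add: V_def t_def)
  next
    fix P p
    assume "p \<in> V" and zero: "\<And>u v w. eval2 g u v \<noteq> 0 \<Longrightarrow> eval2 g u v * w\<^sup>2 = eval2 M u v \<Longrightarrow>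
      eval3 P (w, v, w * v * poly e (T u v) / poly d (T u v)) = 0"
    obtain x0 y0 z0 where p: "p = (x0, y0, z0)" by (cases p)
    \<comment> \<open>For fixed x and y, \<gamma> is a monic quadratic \<open>?G\<close> in z, and
      \<open>?S\<close> is the equation of the surface in z. Since e is 0 or of smaller degree than
      d, its degree and leading coefficient do not depend on x and y.\<close>
    let ?G = "\<lambda>x y. [:x\<^sup>2 + y\<^sup>2 - 2, - (x * y), 1:]"
    let ?S = "\<lambda>x y. pcompose d (?G x y) * [:0, 1:] - smult (x * y) (pcompose e (?G x y))"
    have G: "poly (?G x y) z = gamma_xyz x y z" for x y z
      by (simp add: gamma_xyz_def algebra_simps power2_eq_square)
    have S: "poly (?S x y) z = poly d (gamma_xyz x y z) * z - x * y * poly e (gamma_xyz x y z)" for x y z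
      by (simp only: poly_diff poly_mult poly_pcompose G poly_smult) simp
    have deg_S: "degree (?S x y) = 2 * degree d + 1 \<and> lead_coeff (?S x y) = lead_coeff d" for x y
    proof -
      let ?L = "pcompose d (?G x y) * [:0, 1:]" and ?R = "- smult (x * y) (pcompose e (?G x y))"
      have "pcompose d (?G x y) \<noteq> 0" using deg by (subst pcompose_eq_0_iff) auto
      then have L: "degree ?L = 2 * degree d + 1" by (simp add: degree_mult_eq degree_pcompose del: mult_pCons_right)
      have "lead_coeff ?L = lead_coeff d"
        by (simp only: lead_coeff_mult) (simp add: lead_coeff_comp)
      moreover have "degree ?R < degree ?L"
        using deg unfolding L by (auto simp: degree_pcompose intro!: le_less_trans[OF degree_smult_le])
      ultimately show ?thesis
        using L degree_add_eq_left[of ?R ?L] lead_coeff_add_le[of ?R ?L] by simp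
    qed
    \<comment> \<open>Where h is nonzero the surface is parametrised: d(t) = 0 would give xy e(t) =
      0, against coprimality, and E = 0 would give u = 0, where E is r(y^2 - 2).\<close>
    have "polyfun2 (\<lambda>x y. x * y * poly r (y\<^sup>2 - 2))"
      by (intro polyfun2_intros polyfun2_poly)
    then obtain h where h: "\<And>x y. eval2 h x y = x * y * poly r (y\<^sup>2 - 2)" by (auto simp: polyfun2_def)
    show "eval3 P p = 0" unfolding p
    proof (rule surface_dense[where P = ?S and h = h and N = "2 * degree d + 1" and c = "lead_coeff d"])
      show "h \<noteq> 0"
      proof
        assume "h = 0"
        then have "y = 0 \<or> poly r (y\<^sup>2 - 2) = 0" for y using h[of 1 y] by simp
        then have "poly ([:0, 1:] * pcompose r [:-2, 0, 1:]) y = 0" for y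
          by (auto simp: poly_pcompose power2_eq_square)
        then have "[:0, 1:] * pcompose r [:-2, 0, 1:] = 0" using poly_all_0_iff_0 by blast
        then show False using \<open>r \<noteq> 0\<close> by (auto simp: pcompose_eq_0_iff)
      qed
      show "polyfun2 (\<lambda>x y. poly (?S x y) z)" for z
        unfolding S gamma_xyz_def by (intro polyfun2_intros polyfun2_poly)
      show "poly (?S x0 y0) z0 = 0" using \<open>p \<in> V\<close> by (simp only: S) (simp add: p V_def mult.commute)
      show "eval3 P (x, y, z) = 0" if "poly (?S x y) z = 0" and h0: "eval2 h x y \<noteq> 0" for x y z
      proof -
        define t where "t = gamma_xyz x y z"
        have z: "z * poly d t = x * y * poly e t" using that(1) unfolding S by (simp add: t_def mult.commute)
        have xy: "x \<noteq> 0" "y \<noteq> 0" "poly r (y\<^sup>2 - 2) \<noteq> 0" using h0 by (auto simp: h)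
        have d0: "poly d t \<noteq> 0" using z xy coprime[of t] by auto
        then have z': "z = x * y * poly e t / poly d t" using z by (simp add: field_simps)
        define u where "u = t + 2 - y\<^sup>2"
        have T: "T u y = t" by (simp add: T_def u_def)
        have "u = x\<^sup>2 + z\<^sup>2 - x * y * z" by (simp add: u_def t_def gamma_xyz_def)
        then have x2: "x\<^sup>2 * ?E t y = u * (poly d t)\<^sup>2"
          using z by algebra
        have E: "?E t y \<noteq> 0"
        proof
          assume E: "?E t y = 0"
          then have "u * (poly d t)\<^sup>2 = 0" using x2 by (simp only: E mult_zero_right)
          then have "u = 0" using d0 by simp
          then have "y\<^sup>2 = 2 + t" by (simp add: u_def add.commute)
          then have "?E t y = poly r t" "t = y\<^sup>2 - 2" by (simp_all flip: r')
          then show False using E xy by simp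
        qed
        have "eval3 P (x, y, x * y * poly e (T u y) / poly d (T u y)) = 0"
          using x2 d0 E by (intro zero) (simp_all add: eval_g eval_M T power2_eq_square power3_eq_cube mult_ac)
        then show ?thesis by (simp add: T z'[symmetric])
      qed
    next
      show "degree (?S x y) = 2 * degree d + 1" "lead_coeff (?S x y) = lead_coeff d" for x y
        using deg_S[of x y] by (rule conjunct1, rule conjunct2)
      show "lead_coeff d \<noteq> 0" using deg by simp
    qed
  qed (auto intro!: cover_fun_w cover_fun_polyfun2 polyfun2_intros)
qed

section \<open>Components and Chebyshev polynomials\<close>

text \<open>The level sets over \<open>C\<close> and the last surface are irreducible, so it remains
  to see that none of them contains another.\<close>

lemma card_components_two_bridge:
  fixes d e r :: "complex poly"
  assumes deg: "d \<noteq> 0" "e = 0 \<or> degree e < degree d"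
    and "r \<noteq> 0" and r: "d\<^sup>2 - [:2, 1:] * e * (d - e) = r"
    and coprime: "\<And>t. poly d t = 0 \<Longrightarrow> poly e t \<noteq> 0"
    and "finite C"
  shows "card (irreducible_components {(x, y, z). gamma_xyz x y z \<in> C \<or>
    z * poly d (gamma_xyz x y z) = x * y * poly e (gamma_xyz x y z)}) = card C + 1"
proof -
  define L where "L c = {(x, y, z). gamma_xyz x y z = c}" for c
  define S where "S = {(x, y, z). z * poly d (gamma_xyz x y z) = x * y * poly e (gamma_xyz x y z)}"
  have inL: "(x, y, z) \<in> L c \<longleftrightarrow> gamma_xyz x y z = c" for x y z c by (simp add: L_def)
  have inS: "(x, y, z) \<in> S \<longleftrightarrow> z * poly d (gamma_xyz x y z) = x * y * poly e (gamma_xyz x y z)" for x y z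
    by (simp add: S_def)
  have L_sub: "c = c'" if "L c \<subseteq> L c'" for c c'
  proof -
    have "(csqrt (c + 2), 0, 0) \<in> L c" by (simp add: inL gamma_xyz_def)
    then have "(csqrt (c + 2), 0, 0) \<in> L c'" using that by blast
    then show ?thesis by (simp add: inL gamma_xyz_def)
  qed
  have S_L: "\<not> S \<subseteq> L c" for c
  proof
    assume *: "S \<subseteq> L c"
    have "(0, 0, 0) \<in> S" "(1, 0, 0) \<in> S" by (simp_all add: inS)
    then have "(0, 0, 0) \<in> L c" "(1, 0, 0) \<in> L c" using * by blast+
    then show False by (auto simp: inL gamma_xyz_def)
  qed
  have L_S: "\<not> L c \<subseteq> S" for c
  proof
    assume *: "L c \<subseteq> S"
    \<comment> \<open>This x makes c + 2 - x^2 nonzero, so that the point (x, 0, z) of the level set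
      has z nonzero. On the surface this forces d(c) = 0.\<close>
    define x where "x = (if c + 2 = 0 then 1 else 0 :: complex)"
    define z where "z = csqrt (c + 2 - x\<^sup>2)"
    have "z \<noteq> 0" by (auto simp: z_def x_def)
    have "(x, 0, z) \<in> L c" by (simp add: inL gamma_xyz_def z_def)
    then have "(x, 0, z) \<in> S" "gamma_xyz x 0 z = c" using * by (auto simp: inL)
    then have d: "poly d c = 0" using \<open>z \<noteq> 0\<close> by (simp add: inS)
    \<comment> \<open>A root of w^2 - w = c, the equation of the level set at x = y = 1. With d(c) =
      0 the surface equation leaves e(c) = 0.\<close>
    define w where "w = (1 + csqrt (4 * c + 1)) / 2"
    have "2 * w - 1 = csqrt (4 * c + 1)" by (simp add: w_def diff_eq_eq add_divide_distrib distrib_left)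
    then have "(2 * w - 1)\<^sup>2 = 4 * c + 1" by simp
    then have "4 * gamma_xyz 1 1 w = 4 * c" by (simp add: gamma_xyz_def power2_eq_square algebra_simps)
    then have "(1, 1, w) \<in> L c" "gamma_xyz 1 1 w = c" by (simp_all add: inL)
    then have "(1, 1, w) \<in> S" using * by blast
    then have "poly e c = 0" using d by (simp add: inS \<open>gamma_xyz 1 1 w = c\<close>)
    then show False using d coprime by blast
  qed
  have "irreducible_components (\<Union>(insert S (L ` C))) = insert S (L ` C)"
  proof (rule irreducible_components_Union)
    show "irreducible_algebraic_set A" if "A \<in> insert S (L ` C)" for A
      using that irreducible_gamma_level irreducible_two_bridge_surface[OF assms(1-5)]
      by (auto simp: L_def S_def)
    show "A = B" if "A \<in> insert S (L ` C)" "B \<in> insert S (L ` C)" "A \<subseteq> B" for A B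
      using that L_sub S_L L_S by blast
  qed (use \<open>finite C\<close> in auto)
  moreover have "{(x, y, z). gamma_xyz x y z \<in> C \<or>
    z * poly d (gamma_xyz x y z) = x * y * poly e (gamma_xyz x y z)} = \<Union>(insert S (L ` C))"
    by (auto simp: L_def S_def)
  moreover have "card (insert S (L ` C)) = card C + 1"
  proof -
    have "S \<notin> L ` C" using S_L by auto
    moreover have "inj_on L C" using L_sub by (auto intro: inj_onI)
    ultimately show ?thesis using \<open>finite C\<close> by (simp add: card_image)
  qed
  ultimately show ?thesis by simp
qed

section \<open>Chebyshev polynomials and their roots\<close>

text \<open>The index is shifted by one: \<open>cheb n\<close> is the polynomial S_{n-1}, starting
  from S_{-1} = 0.\<close>

fun cheb :: "nat \<Rightarrow> complex poly" where
  "cheb 0 = 0"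
| "cheb (Suc 0) = 1"
| "cheb (Suc (Suc i)) = [:0, 1:] * cheb (Suc i) - cheb i"

lemma poly_cheb: "poly (cheb i) t = chebyshev_S_aux i t"
  by (induction i rule: cheb.induct) auto

lemma chebyshev_S_eq_cheb: "chebyshev_S (int n - 1) t = poly (cheb n) t"
  by (simp add: chebyshev_S_def poly_cheb)

lemma degree_cheb_aux: "degree (cheb (Suc n)) = n \<and> lead_coeff (cheb (Suc n)) = 1 \<and> degree (cheb n) \<le> n - 1"
proof (induction n)
  case (Suc n)
  have IH: "degree (cheb (Suc n)) = n" "coeff (cheb (Suc n)) n = 1"
    using Suc by auto
  have lc: "lead_coeff ([:0, 1:] * cheb (Suc n)) = 1"
    by (simp only: lead_coeff_mult) (simp add: IH)
  have "cheb (Suc n) \<noteq> 0" using Suc by auto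
  then have dg: "degree ([:0, 1:] * cheb (Suc n)) = Suc n"
    using Suc by (simp add: degree_mult_eq del: mult_pCons_left)
  have "degree (- cheb n) < Suc n" using Suc by auto
  then have "degree (cheb (Suc (Suc n))) = Suc n" "lead_coeff (cheb (Suc (Suc n))) = 1"
    using degree_add_eq_left[of "- cheb n" "[:0, 1:] * cheb (Suc n)"]
      lead_coeff_add_le[of "- cheb n" "[:0, 1:] * cheb (Suc n)"] lc dg
    by (simp_all del: mult_pCons_left)
  then show ?case using Suc by simp
qed simp

lemma degree_cheb: "degree (cheb (Suc n)) = n" and cheb_Suc_nonzero: "cheb (Suc n) \<noteq> 0"
  using degree_cheb_aux[of n] by auto

lemma degree_cheb_le: "degree (cheb n) \<le> n - 1"
  using degree_cheb_aux by blast

lemma degree_cheb_add: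
  assumes "degree q < n \<or> q = 0"
  shows "degree (cheb (Suc n) + q) = n" "cheb (Suc n) + q \<noteq> 0"
proof -
  show 1: "degree (cheb (Suc n) + q) = n"
    using assms degree_add_eq_left[of q "cheb (Suc n)"] by (auto simp: degree_cheb)
  show "cheb (Suc n) + q \<noteq> 0"
    using 1 assms cheb_Suc_nonzero[of n] by (cases "n = 0") auto
qed

text \<open>The quadratic form X^2 + Y^2 - tXY is invariant under the step (X, Y) -> (tX - Y, X) of
  the recurrence and equals 1 at (1, 0).\<close>

lemma cheb_norm: "(cheb (Suc n))\<^sup>2 + (cheb n)\<^sup>2 - [:0, 1:] * cheb n * cheb (Suc n) = 1"
proof (induction n)
  case (Suc n)
  show ?case unfolding Suc[symmetric] cheb.simps by algebra
qed simp

text \<open>The classical quotient sin(n \<theta>) / sin \<theta>, cleared of its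
  denominator.\<close>

lemma poly_cheb_cos: "poly (cheb n) (of_real (2 * cos \<theta>)) * of_real (sin \<theta>) = of_real (sin (real n * \<theta>))"
proof (induction n rule: cheb.induct)
  case (3 i)
  have S: "sin (real (Suc (Suc i)) * \<theta>) = 2 * cos \<theta> * sin (real (Suc i) * \<theta>) - sin (real i * \<theta>)"
  proof -
    have "real (Suc (Suc i)) * \<theta> = real (Suc i) * \<theta> + \<theta>" "real i * \<theta> = real (Suc i) * \<theta> - \<theta>"
      by (simp_all add: algebra_simps)
    then show ?thesis by (simp only: sin_add sin_diff) simp
  qed
  have R: "poly (cheb (Suc (Suc i))) t * s = t * (poly (cheb (Suc i)) t * s) - poly (cheb i) t * s" for t s
    by (simp add: algebra_simps)
  show ?case by (unfold R 3 S) simp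
qed simp_all

lemma poly_cheb_2: "poly (cheb n) 2 = of_nat n"
  by (induction n rule: cheb.induct) auto

text \<open>The cosine is injective on [0, \<pi>], so the given roots are distinct, and the degree
  leaves room for no others.\<close>

lemma roots_eq_image:
  fixes p :: "complex poly" and \<theta> :: "nat \<Rightarrow> real"
  assumes "p \<noteq> 0" "degree p = n"
    and root: "\<And>j. j \<in> {1..n} \<Longrightarrow> poly p (of_real (2 * cos (\<theta> j))) = 0"
    and \<theta>: "\<And>j. j \<in> {1..n} \<Longrightarrow> 0 \<le> \<theta> j \<and> \<theta> j \<le> pi" "inj_on \<theta> {1..n}"
  shows "{t. poly p t = 0} = (\<lambda>j. of_real (2 * cos (\<theta> j))) ` {1..n}" "card {t. poly p t = 0} = n"
proof -
  have "inj_on (\<lambda>j. complex_of_real (2 * cos (\<theta> j))) {1..n}"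
  proof (rule inj_onI)
    fix i j assume ij: "i \<in> {1..n}" "j \<in> {1..n}"
      and "complex_of_real (2 * cos (\<theta> i)) = complex_of_real (2 * cos (\<theta> j))"
    then have "cos (\<theta> i) = cos (\<theta> j)" by (simp flip: of_real_mult)
    then have "\<theta> i = \<theta> j" using \<theta>(1) ij by (metis arccos_cos)
    then show "i = j" using \<theta>(2) ij by (auto dest: inj_onD)
  qed
  then have card: "card ((\<lambda>j. complex_of_real (2 * cos (\<theta> j))) ` {1..n}) = n"
    by (simp add: card_image)
  moreover have "(\<lambda>j. complex_of_real (2 * cos (\<theta> j))) ` {1..n} \<subseteq> {t. poly p t = 0}"
    using root by auto
  ultimately show eq: "{t. poly p t = 0} = (\<lambda>j. of_real (2 * cos (\<theta> j))) ` {1..n}"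
    using card_poly_roots_bound[OF \<open>p \<noteq> 0\<close>] poly_roots_finite[OF \<open>p \<noteq> 0\<close>] \<open>degree p = n\<close>
    by (metis card_seteq)
  show "card {t. poly p t = 0} = n" using card eq by simp
qed

lemma cheb_roots:
  fixes n defines "\<theta> \<equiv> \<lambda>j. real j * pi / real n"
  assumes "n \<ge> 1"
  shows "{t. poly (cheb n) t = 0} = (\<lambda>j. of_real (2 * cos (\<theta> j))) ` {1..n - 1}"
    "card {t. poly (cheb n) t = 0} = n - 1"
proof -
  obtain m where n: "n = Suc m" using assms by (cases n) auto
  have \<theta>: "0 < \<theta> j \<and> \<theta> j < pi" if "j \<in> {1..n - 1}" for j
    using that \<open>n \<ge> 1\<close> by (auto simp: \<theta>_def field_simps)
  have "poly (cheb n) (of_real (2 * cos (\<theta> j))) = 0" if j: "j \<in> {1..n - 1}" for j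
  proof -
    have "real n * \<theta> j = real j * pi" using assms by (simp add: \<theta>_def)
    then have "poly (cheb n) (of_real (2 * cos (\<theta> j))) * of_real (sin (\<theta> j)) = 0"
      using poly_cheb_cos[of n "\<theta> j"] by (simp add: sin_npi)
    moreover have "sin (\<theta> j) \<noteq> 0" using sin_gt_zero[of "\<theta> j"] \<theta>[OF j] by simp
    ultimately show ?thesis by simp
  qed
  moreover have "inj_on \<theta> {1..n - 1}" using assms by (auto simp: inj_on_def \<theta>_def)
  moreover have "cheb n \<noteq> 0" "degree (cheb n) = n - 1" using n cheb_Suc_nonzero degree_cheb by auto
  ultimately show "{t. poly (cheb n) t = 0} = (\<lambda>j. of_real (2 * cos (\<theta> j))) ` {1..n - 1}"
    "card {t. poly (cheb n) t = 0} = n - 1"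
    using roots_eq_image[of "cheb n" "n - 1" \<theta>] \<theta> by (auto simp: less_imp_le)
qed

lemma cheb_diff_roots:
  fixes n defines "\<theta> \<equiv> \<lambda>j. (2 * real j - 1) * pi / real (2 * n + 1)"
  shows "{t. poly (cheb (Suc n) - cheb n) t = 0} = (\<lambda>j. of_real (2 * cos (\<theta> j))) ` {1..n}"
    "card {t. poly (cheb (Suc n) - cheb n) t = 0} = n"
proof -
  have \<theta>: "0 < \<theta> j \<and> \<theta> j < pi" if "j \<in> {1..n}" for j
  proof -
    have "0 < 2 * real j - 1" "2 * real j - 1 < real (2 * n + 1)" using that by auto
    moreover from this have "(2 * real j - 1) * pi < real (2 * n + 1) * pi"
      by (intro mult_strict_right_mono) simp_all
    ultimately show ?thesis
      unfolding \<theta>_def by (simp add: pos_divide_less_eq mult.commute)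
  qed
  have "poly (cheb (Suc n) - cheb n) (of_real (2 * cos (\<theta> j))) = 0" if j: "j \<in> {1..n}" for j
  proof -
    have "real (2 * n + 1) * \<theta> j = (2 * real j - 1) * pi" by (simp add: \<theta>_def del: of_nat_add of_nat_mult)
    \<comment> \<open>As (2n + 1) \<theta> is an odd multiple of \<pi>, (n + 1) \<theta> and n
      \<theta> have equal sines. The natural subtraction j - 1 is exact because j is at least
      1.\<close>
    then have "real (Suc n) * \<theta> j = pi + 2 * real (j - 1) * pi - real n * \<theta> j"
      using j by (simp add: algebra_simps of_nat_diff)
    then have "sin (real (Suc n) * \<theta> j) = sin (pi + 2 * real (j - 1) * pi - real n * \<theta> j)" by simp
    also have "\<dots> = sin (pi - real n * \<theta> j + 2 * real (j - 1) * pi)" by (simp add: algebra_simps)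
    also have "\<dots> = sin (real n * \<theta> j)"
      by (simp only: sin_add sin_pi_minus cos_2npi sin_2npi)
    finally have "poly (cheb (Suc n) - cheb n) (of_real (2 * cos (\<theta> j))) * of_real (sin (\<theta> j)) = 0"
      using poly_cheb_cos[of n "\<theta> j"] poly_cheb_cos[of "Suc n" "\<theta> j"]
      by (simp only: poly_diff left_diff_distrib) simp
    moreover have "sin (\<theta> j) \<noteq> 0" using sin_gt_zero[of "\<theta> j"] \<theta>[OF j] by simp
    ultimately show ?thesis by simp
  qed
  moreover have "inj_on \<theta> {1..n}"
  proof (rule inj_onI)
    fix i j assume "\<theta> i = \<theta> j"
    moreover have "real (2 * n + 1) \<noteq> 0" by simp
    ultimately have "(2 * real i - 1) * pi = (2 * real j - 1) * pi"
      unfolding \<theta>_def by (metis divide_cancel_right)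
    then show "i = j" by simp
  qed
  moreover have "degree (- cheb n) < n \<or> - cheb n = 0"
    using degree_cheb_le[of n] by (cases "n = 0") auto
  note degree_cheb_add[OF this]
  ultimately show "{t. poly (cheb (Suc n) - cheb n) t = 0} = (\<lambda>j. of_real (2 * cos (\<theta> j))) ` {1..n}"
    "card {t. poly (cheb (Suc n) - cheb n) t = 0} = n"
    using roots_eq_image[of "cheb (Suc n) - cheb n" n \<theta>] \<theta> by (auto simp: less_imp_le)
qed

section \<open>Palindromic words in two matrices\<close>

lemma trace2: "trace (A :: 'a::comm_ring_1^2^2) = A$1$1 + A$2$2"
  by (simp add: trace_def sum_2)

text \<open>The adjugate, which is the inverse on matrices of determinant 1. Being linear in the
  entries, it keeps matrix identities within polynomial algebra.\<close>

definition inv2 :: "complex^2^2 \<Rightarrow> complex^2^2" where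
  "inv2 A = (\<chi> i j. (if i = j then trace A else 0) - A$i$j)"

definition pal_span :: "complex^2^2 \<Rightarrow> complex^2^2 \<Rightarrow> complex \<Rightarrow> complex \<Rightarrow> complex \<Rightarrow> complex^2^2" where
  "pal_span A B \<alpha> \<beta> \<delta> = (\<chi> i j. (if i = j then \<alpha> else 0) + \<beta> * A$i$j + \<delta> * B$i$j)"

lemmas mat2_simps = vec_eq_iff forall_2 matrix_matrix_mult_def sum_2 mat_def

lemma inv2_mult: "det A = 1 \<Longrightarrow> A ** inv2 A = mat 1" "det A = 1 \<Longrightarrow> inv2 A ** A = mat 1"
  by (simp_all add: mat2_simps inv2_def trace2 det_2) algebra+

lemma det_inv2: "det (inv2 A) = det A"
  by (simp add: inv2_def trace2 det_2)

lemma pal_swap: "pal_span A B \<alpha> \<beta> \<delta> = pal_span B A \<alpha> \<delta> \<beta>"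
  by (simp add: pal_span_def algebra_simps)

text \<open>Cayley-Hamilton gives AA = xA - 1 and ABA = zA + B - y. Thus the span of 1, A, B is
  stable under X -> AXA, which is how palindromes stay in it.\<close>

lemma pal_sandwich:
  assumes "det A = 1" "det B = 1"
  defines "x \<equiv> trace A" and "y \<equiv> trace B" and "z \<equiv> trace (A ** B)"
  shows "A ** pal_span A B \<alpha> \<beta> \<delta> ** A = pal_span A B (-\<alpha> - x*\<beta> - y*\<delta>) (x*\<alpha> + (x\<^sup>2 - 1)*\<beta> + z*\<delta>) \<delta>"
  using assms(1,2) unfolding x_def y_def z_def
  apply (simp add: mat2_simps pal_span_def trace2 det_2)
  apply (intro conjI; algebra)
  done

text \<open>The terms in 1 and A commute with A, so only the B term contributes.\<close>

lemma pal_commutator: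
  "A ** pal_span A B \<alpha> \<beta> \<delta> = pal_span A B \<alpha> \<beta> \<delta> ** A \<longleftrightarrow> \<delta> = 0 \<or> A ** B = B ** A"
proof -
  have "A ** pal_span A B \<alpha> \<beta> \<delta> - pal_span A B \<alpha> \<beta> \<delta> ** A = (\<chi> i j. \<delta> * (A ** B - B ** A)$i$j)"
    by (simp add: mat2_simps pal_span_def algebra_simps)
  then have "A ** pal_span A B \<alpha> \<beta> \<delta> = pal_span A B \<alpha> \<beta> \<delta> ** A \<longleftrightarrow> (\<chi> i j. \<delta> * (A ** B - B ** A)$i$j) = 0"
    by (metis right_minus_eq)
  also have "\<dots> \<longleftrightarrow> \<delta> = 0 \<or> A ** B - B ** A = 0"
    by (auto simp: vec_eq_iff)
  finally show ?thesis by simp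
qed

text \<open>The two summands are reversals of each other as words. Their sum is symmetric under
  reversal and falls into the span, although a single summand need not.\<close>

lemma pal_conj_sum:
  assumes "det A = 1" "det B = 1"
  defines "x \<equiv> trace A" and "y \<equiv> trace B" and "z \<equiv> trace (A ** B)"
  shows "B ** A ** inv2 B + inv2 B ** A ** B = pal_span A B (y * (z - x*y) + 2*x) (y\<^sup>2 - 2) (x*y - 2*z)"
    "inv2 B ** inv2 A ** B + B ** inv2 A ** inv2 B = pal_span A B (x * y\<^sup>2 - y*z) (2 - y\<^sup>2) (2*z - x*y)"
  using assms(1,2) unfolding x_def y_def z_def
   apply (simp_all add: mat2_simps pal_span_def trace2 det_2 inv2_def)
   apply (intro conjI; algebra)
  apply (intro conjI; algebra)
  done

section \<open>Representations of the link group\<close>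

fun word_val :: "('g \<Rightarrow> complex^2^2) \<Rightarrow> 'g word \<Rightarrow> complex^2^2" where
  "word_val f [] = mat 1"
| "word_val f ((g, s) # w) = (if s then f g else inv2 (f g)) ** word_val f w"

lemma word_val_append: "word_val f (u @ v) = word_val f u ** word_val f v"
  by (induction f u rule: word_val.induct) (auto simp: matrix_mul_assoc)

lemma word_val_eq:
  assumes "word_eq R u v" and det: "\<And>g. det (f g) = 1"
    and "\<And>u v. (u, v) \<in> R \<Longrightarrow> word_val f u = word_val f v"
  shows "word_val f u = word_val f v"
  using assms(1)
proof induction
  case (cancel g s)
  then show ?case by (cases s) (auto simp: inv2_mult det)
qed (auto simp: word_val_append assms)

lemma det_word_val: "(\<And>g. det (f g) = 1) \<Longrightarrow> det (word_val f u) = 1"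
  by (induction f u rule: word_val.induct) (auto simp: det_mul det_inv2)

text \<open>The universal property of the presentation: by \<open>word_val_eq\<close>, the value
  does not depend on the representative chosen from a class.\<close>

lemma presented_hom_exists:
  assumes det: "\<And>g. det (f g) = 1"
    and rel: "\<And>u v. (u, v) \<in> R \<Longrightarrow> word_val f u = word_val f v"
  obtains \<rho> where "\<rho> \<in> hom (presented_group R) SL2C" "\<And>u. \<rho> (word_class R u) = word_val f u"
proof -
  define \<rho> where "\<rho> X = word_val f (SOME u. u \<in> X)" for X
  have \<rho>: "\<rho> (word_class R u) = word_val f u" for u
  proof -
    have "u \<in> word_class R u" by (simp add: word_class_def word_eq.refl)
    then have "(SOME v. v \<in> word_class R u) \<in> word_class R u" by (rule someI)
    then have "word_eq R u (SOME v. v \<in> word_class R u)" by (simp only: word_class_def mem_Collect_eq)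
    from word_val_eq[OF this det rel] show ?thesis by (simp add: \<rho>_def)
  qed
  have "\<rho> \<in> hom (presented_group R) SL2C"
  proof (rule homI)
    fix X assume "X \<in> carrier (presented_group R)"
    then obtain u where "X = word_class R u" by (auto simp: presented_group_def)
    then show "\<rho> X \<in> carrier SL2C" by (simp add: \<rho> SL2C_def det_word_val det)
  next
    fix X Y assume "X \<in> carrier (presented_group R)" "Y \<in> carrier (presented_group R)"
    then obtain u v where "X = word_class R u" "Y = word_class R v" by (auto simp: presented_group_def)
    then show "\<rho> (X \<otimes>\<^bsub>presented_group R\<^esub> Y) = \<rho> X \<otimes>\<^bsub>SL2C\<^esub> \<rho> Y"
      by (simp add: presented_mult \<rho> word_val_append) (simp add: SL2C_def)
  qed
  then show thesis using \<rho> by (rule that)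
qed

lemma word_class_carrier: "word_class R u \<in> carrier (presented_group R)"
  by (simp add: presented_group_def)

lemma presented_hom_word:
  assumes \<rho>: "\<rho> \<in> hom (presented_group R) SL2C"
  defines "f \<equiv> \<lambda>g. \<rho> (gen_elem R g)"
  shows "det (f g) = 1" "\<rho> (word_class R u) = word_val f u"
proof -
  have mult: "\<rho> (word_class R (u @ v)) = \<rho> (word_class R u) ** \<rho> (word_class R v)" for u v
    using hom_mult[OF \<rho> word_class_carrier word_class_carrier, of u v]
    by (simp add: presented_mult) (simp add: SL2C_def)
  have det: "det (f g) = 1" for g
    using hom_in_carrier[OF \<rho> word_class_carrier, of "[(g, True)]"]
    by (simp add: f_def gen_elem_def SL2C_def)
  then show "det (f g) = 1" .
  have one: "\<rho> (word_class R []) = mat 1"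
    using hom_one[OF \<rho> group_presented_group group_SL2C] by (simp add: presented_group_def SL2C_def)
  have inv: "\<rho> (word_class R [(g, False)]) = inv2 (f g)" for g
  proof -
    have "word_class R ([(g, True)] @ [(g, False)]) = word_class R []"
      using word_eq.cancel[of R g True] by (simp add: word_class_eq_iff)
    then have "f g ** \<rho> (word_class R [(g, False)]) = mat 1"
      using mult[of "[(g, True)]" "[(g, False)]"] one by (simp add: f_def gen_elem_def)
    then have "inv2 (f g) ** (f g ** \<rho> (word_class R [(g, False)])) = inv2 (f g)" by simp
    then show ?thesis by (simp add: matrix_mul_assoc inv2_mult det)
  qed
  show "\<rho> (word_class R u) = word_val f u"
  proof (induction u)
    case (Cons l u)
    obtain g s where "l = (g, s)" by (cases l)
    then show ?case using mult[of "[l]" u] Cons inv[of g]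
      by (cases s) (simp_all add: f_def gen_elem_def)
  qed (simp add: one)
qed

lemma traces_surj:
  obtains A B :: "complex^2^2" where "det A = 1" "det B = 1" "trace A = x" "trace B = y" "trace (A ** B) = z"
proof -
  \<comment> \<open>A root of q^2 - zq + 1 = 0, which gives B determinant 1, while the trace of AB
    is q - (q - z) = z.\<close>
  define q where "q = (z + csqrt (z\<^sup>2 - 4)) / 2"
  have "2 * q - z = csqrt (z\<^sup>2 - 4)" by (simp add: q_def add_divide_distrib distrib_left)
  then have "(2 * q - z)\<^sup>2 = z\<^sup>2 - 4" by simp
  then have q: "q * (q - z) = -1" by algebra
  define A :: "complex^2^2" where "A = vector [vector [x, -1], vector [1, 0]]"
  define B :: "complex^2^2" where "B = vector [vector [0, q], vector [q - z, y]]"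
  show thesis
  proof (rule that[of A B])
    show "det B = 1" using q by (simp add: B_def det_2 algebra_simps)
  qed (simp_all add: A_def B_def det_2 trace2 matrix_matrix_mult_def sum_2)
qed

text \<open>The determinant of AB - BA equals 2 - \<gamma>.\<close>

lemma commuting_gamma:
  fixes A B :: "complex^2^2"
  assumes "det A = 1" "det B = 1" "A ** B = B ** A"
  shows "gamma_xyz (trace A) (trace B) (trace (A ** B)) = 2"
proof -
  have "det (A ** B - B ** A) = 2 - gamma_xyz (trace A) (trace B) (trace (A ** B))"
    using assms(1,2) unfolding gamma_xyz_def
    by (simp add: det_2 trace2 matrix_matrix_mult_def sum_2) algebra
  then show ?thesis using assms(3) by (simp add: det_2)
qed

text \<open>Diagonal matrices suffice. With x = u + 1/u and y = v + 1/v, \<gamma> - 2 is quadratic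
  in z with roots uv + 1/(uv) and u/v + v/u, and replacing v by 1/v exchanges these.\<close>

lemma gamma_commuting:
  assumes "gamma_xyz x y z = 2"
  obtains A B :: "complex^2^2" where "det A = 1" "det B = 1" "trace A = x" "trace B = y" "trace (A ** B) = z"
    "A ** B = B ** A"
proof -
  have ex: "\<exists>u. u \<noteq> 0 \<and> x = u + 1/u" for x :: complex
  proof -
    define u where "u = (x + csqrt (x\<^sup>2 - 4)) / 2"
    have "2 * u - x = csqrt (x\<^sup>2 - 4)" by (simp add: u_def add_divide_distrib distrib_left)
    then have "(2 * u - x)\<^sup>2 = x\<^sup>2 - 4" by simp
    then have "u * (x - u) = 1" by algebra
    moreover from this have "u \<noteq> 0" by auto
    ultimately have "x - u = 1/u" by (simp add: eq_divide_eq mult.commute)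
    then have "x = u + 1/u" by (simp add: diff_eq_eq add.commute)
    with \<open>u \<noteq> 0\<close> show ?thesis by blast
  qed
  obtain u where u: "u \<noteq> 0" "x = u + 1/u" using ex by blast
  have "\<exists>v. v \<noteq> 0 \<and> y = v + 1/v \<and> z = u * v + 1/(u * v)"
  proof -
    obtain v where v: "v \<noteq> 0" "y = v + 1/v" using ex by blast
    define u' v' where uv': "u' = 1/u" "v' = 1/v"
    have "u * u' = 1" "v * v' = 1" "x = u + u'" "y = v + v'" using u v by (simp_all add: uv')
    then have "(z - (u * v + u' * v')) * (z - (u * v' + u' * v)) = gamma_xyz x y z - 2"
      unfolding gamma_xyz_def by algebra
    then have "z = u * v + 1/(u * v) \<or> z = u * (1/v) + 1/(u * (1/v))" using assms by (auto simp: uv')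
    then show ?thesis
    proof
      assume "z = u * (1/v) + 1/(u * (1/v))"
      then show ?thesis using v by (intro exI[of _ "1/v"]) simp
    qed (use v in blast)
  qed
  then obtain v where v: "v \<noteq> 0" "y = v + 1/v" "z = u * v + 1/(u * v)" by blast
  define A :: "complex^2^2" where "A = vector [vector [u, 0], vector [0, 1/u]]"
  define B :: "complex^2^2" where "B = vector [vector [v, 0], vector [0, 1/v]]"
  show thesis
    by (rule that[of A B]) (use u v in \<open>simp_all add: A_def B_def det_2 trace2 mat2_simps\<close>)
qed

text \<open>The relation holds for (A, B) iff \<open>\<Delta>\<close> vanishes at its traces or A
  and B commute. Every triple is realised by some pair, and commuting pairs realise exactly those
  with \<gamma> = 2.\<close>

lemma character_variety_palindrome:
  fixes w :: "meridian word" and \<Delta> :: "complex \<Rightarrow> complex \<Rightarrow> complex \<Rightarrow> complex"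
  assumes pal: "\<And>A B. det A = 1 \<Longrightarrow> det B = 1 \<Longrightarrow>
    \<exists>\<alpha> \<beta>. word_val (case_meridian A B) w = pal_span A B \<alpha> \<beta> (\<Delta> (trace A) (trace B) (trace (A ** B)))"
  defines "R \<equiv> {([(Mer_a, True)] @ w, w @ [(Mer_a, True)])}"
  shows "character_variety (presented_group R) (gen_elem R Mer_a) (gen_elem R Mer_b) =
    {(x, y, z). gamma_xyz x y z = 2 \<or> \<Delta> x y z = 0}"
proof -
  have ab: "gen_elem R Mer_a \<otimes>\<^bsub>presented_group R\<^esub> gen_elem R Mer_b = word_class R [(Mer_a, True), (Mer_b, True)]"
    by (simp add: gen_elem_def presented_mult)
  have rel_iff: "A ** word_val (case_meridian A B) w = word_val (case_meridian A B) w ** A \<longleftrightarrow>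
      \<Delta> (trace A) (trace B) (trace (A ** B)) = 0 \<or> A ** B = B ** A"
    if det: "det A = 1" "det B = 1" for A B
  proof -
    obtain \<alpha> \<beta> where W: "word_val (case_meridian A B) w = pal_span A B \<alpha> \<beta> (\<Delta> (trace A) (trace B) (trace (A ** B)))"
      using pal[OF det] by blast
    show ?thesis unfolding W by (rule pal_commutator)
  qed
  have sol: "(trace A, trace B, trace (A ** B)) \<in>
      character_variety (presented_group R) (gen_elem R Mer_a) (gen_elem R Mer_b)"
    if det: "det A = 1" "det B = 1" and AB: "\<Delta> (trace A) (trace B) (trace (A ** B)) = 0 \<or> A ** B = B ** A"
    for A B :: "complex^2^2"
  proof -
    have "det (case_meridian A B g) = 1" for g using det by (cases g) auto
    moreover have "word_val (case_meridian A B) u = word_val (case_meridian A B) v" if "(u, v) \<in> R" for u v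
      using that rel_iff[OF det] AB by (auto simp: R_def word_val_append)
    ultimately obtain \<rho> where \<rho>: "\<rho> \<in> hom (presented_group R) SL2C"
      "\<And>u. \<rho> (word_class R u) = word_val (case_meridian A B) u"
      by (rule presented_hom_exists) blast+
    show ?thesis unfolding character_variety_def ab
      by (rule CollectI, rule exI[of _ \<rho>]) (simp add: \<rho> gen_elem_def)
  qed
  show ?thesis
  proof (intro equalityI subsetI)
    fix p assume "p \<in> character_variety (presented_group R) (gen_elem R Mer_a) (gen_elem R Mer_b)"
    then obtain \<rho> where \<rho>: "\<rho> \<in> hom (presented_group R) SL2C"
      and p: "p = (trace (\<rho> (gen_elem R Mer_a)), trace (\<rho> (gen_elem R Mer_b)),
        trace (\<rho> (word_class R [(Mer_a, True), (Mer_b, True)])))"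
      unfolding character_variety_def ab by blast
    define A B where "A = \<rho> (gen_elem R Mer_a)" and "B = \<rho> (gen_elem R Mer_b)"
    have f: "(\<lambda>g. \<rho> (gen_elem R g)) = case_meridian A B"
      by (auto simp: A_def B_def split: meridian.split)
    note word = presented_hom_word[OF \<rho>, unfolded f]
    have det: "det A = 1" "det B = 1" 
      using word(1)[of Mer_a] word(1)[of Mer_b] by (simp_all add: A_def B_def)
    have "word_class R ([(Mer_a, True)] @ w) = word_class R (w @ [(Mer_a, True)])"
      by (simp only: word_class_eq_iff) (rule word_eq.relation, simp add: R_def)
    then have "word_val (case_meridian A B) ([(Mer_a, True)] @ w) = word_val (case_meridian A B) (w @ [(Mer_a, True)])"
      by (simp only: word(2)[symmetric])
    then have "\<Delta> (trace A) (trace B) (trace (A ** B)) = 0 \<or> A ** B = B ** A"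
      using rel_iff[OF det] by (simp add: word_val_append)
    moreover have "p = (trace A, trace B, trace (A ** B))"
      by (simp add: p word(2)) (simp add: A_def B_def)
    ultimately show "p \<in> {(x, y, z). gamma_xyz x y z = 2 \<or> \<Delta> x y z = 0}"
      using commuting_gamma[OF det] by auto
  next
    fix p assume "p \<in> {(x, y, z). gamma_xyz x y z = 2 \<or> \<Delta> x y z = 0}"
    then obtain x y z where p: "p = (x, y, z)" and "gamma_xyz x y z = 2 \<or> \<Delta> x y z = 0" by auto
    from this(2) show "p \<in> character_variety (presented_group R) (gen_elem R Mer_a) (gen_elem R Mer_b)"
    proof
      assume "gamma_xyz x y z = 2"
      then obtain A B :: "complex^2^2" where "det A = 1" "det B = 1" "trace A = x" "trace B = y"
        "trace (A ** B) = z" "A ** B = B ** A" by (rule gamma_commuting)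
      then show ?thesis using sol[of A B] by (simp add: p)
    next
      assume "\<Delta> x y z = 0"
      moreover obtain A B :: "complex^2^2" where "det A = 1" "det B = 1" "trace A = x" "trace B = y"
        "trace (A ** B) = z" by (rule traces_surj)
      ultimately show ?thesis using sol[of A B] by (simp add: p)
    qed
  qed
qed

section \<open>Powers of the two commutators\<close>

primrec mat_pow :: "complex^2^2 \<Rightarrow> nat \<Rightarrow> complex^2^2" where
  "mat_pow C 0 = mat 1"
| "mat_pow C (Suc i) = mat_pow C i ** C"

text \<open>The matrix sC - t, the form that Cayley-Hamilton gives to every power of C.\<close>

definition shift_mat :: "complex \<Rightarrow> complex^2^2 \<Rightarrow> complex \<Rightarrow> complex^2^2" where
  "shift_mat s C t = (\<chi> i j. s * C$i$j - (if i = j then t else 0))"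

lemma matrix_add_rdistrib: "(A + B) ** C = A ** C + B ** (C :: 'a::semiring_1^'p^'n)"
  by (simp add: vec_eq_iff matrix_matrix_mult_def sum.distrib distrib_right)

lemma pal_exI: "M = pal_span A B \<alpha> \<beta> \<delta> \<Longrightarrow> \<delta> = \<delta>' \<Longrightarrow> \<exists>\<alpha>' \<beta>'. M = pal_span A B \<alpha>' \<beta>' \<delta>'"
  by blast

lemma shift_mat_mult:
  assumes "det C = 1"
  shows "shift_mat s C t ** C = shift_mat (s * trace C - t) C s"
  using assms by (simp add: mat2_simps shift_mat_def trace2 det_2) (intro conjI; (algebra | simp add: algebra_simps))

text \<open>Multiplication by C acts on the pair (s, t) as the Chebyshev recurrence. The subtracted
  coefficient is S_{n-2}, written through its successors because n = 0 needs S_{-2} = -1.\<close>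

lemma mat_pow_eq:
  assumes "det C = 1"
  shows "mat_pow C n = shift_mat (poly (cheb n) (trace C)) C
    (trace C * poly (cheb n) (trace C) - poly (cheb (Suc n)) (trace C))"
proof (induction n)
  case (Suc n)
  show ?case unfolding mat_pow.simps Suc shift_mat_mult[OF assms] by (simp add: algebra_simps)
qed (simp add: shift_mat_def mat2_simps)

text \<open>In the expansion of (sC - t) X (sC' - t) the mixed terms share the coefficient -st, so
  only the sum CX + XC' has to lie in the span.\<close>

lemma shift_mat_sandwich:
  assumes "C ** X ** C' = pal_span A B \<alpha>\<^sub>1 \<beta>\<^sub>1 \<delta>\<^sub>1" "C ** X + X ** C' = pal_span A B \<alpha>\<^sub>2 \<beta>\<^sub>2 \<delta>\<^sub>2"
    "X = pal_span A B \<alpha>\<^sub>3 \<beta>\<^sub>3 \<delta>\<^sub>3"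
  shows "shift_mat s C t ** X ** shift_mat s C' t = pal_span A B (s\<^sup>2 * \<alpha>\<^sub>1 - s * t * \<alpha>\<^sub>2 + t\<^sup>2 * \<alpha>\<^sub>3)
    (s\<^sup>2 * \<beta>\<^sub>1 - s * t * \<beta>\<^sub>2 + t\<^sup>2 * \<beta>\<^sub>3) (s\<^sup>2 * \<delta>\<^sub>1 - s * t * \<delta>\<^sub>2 + t\<^sup>2 * \<delta>\<^sub>3)"
proof -
  have "shift_mat s C t ** X ** shift_mat s C' t = (\<chi> i j. s\<^sup>2 * (C ** X ** C')$i$j - s * t * (C ** X + X ** C')$i$j + t\<^sup>2 * X$i$j)"
    by (simp add: mat2_simps shift_mat_def algebra_simps power2_eq_square)
  also have "\<dots> = pal_span A B (s\<^sup>2 * \<alpha>\<^sub>1 - s * t * \<alpha>\<^sub>2 + t\<^sup>2 * \<alpha>\<^sub>3)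
    (s\<^sup>2 * \<beta>\<^sub>1 - s * t * \<beta>\<^sub>2 + t\<^sup>2 * \<beta>\<^sub>3) (s\<^sup>2 * \<delta>\<^sub>1 - s * t * \<delta>\<^sub>2 + t\<^sup>2 * \<delta>\<^sub>3)"
    unfolding assms(1,2) by (subst assms(3)) (simp add: pal_span_def mat2_simps algebra_simps)
  finally show ?thesis .
qed

context
  fixes A B :: "complex^2^2" and x y z :: complex and C C' :: "complex^2^2"
  assumes det: "det A = 1" "det B = 1"
  defines "x \<equiv> trace A" and "y \<equiv> trace B" and "z \<equiv> trace (A ** B)"
    and "C \<equiv> B ** A ** inv2 B ** inv2 A" and "C' \<equiv> inv2 A ** inv2 B ** A ** B"
begin

lemma sandwich_A: "A ** pal_span A B \<alpha> \<beta> \<delta> ** A =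
    pal_span A B (-\<alpha> - x*\<beta> - y*\<delta>) (x*\<alpha> + (x\<^sup>2 - 1)*\<beta> + z*\<delta>) \<delta>"
  using pal_sandwich[OF det] by (simp add: x_def y_def z_def)

lemma sandwich_B: "B ** pal_span A B \<alpha> \<beta> \<delta> ** B =
    pal_span A B (-\<alpha> - x*\<beta> - y*\<delta>) \<beta> (y*\<alpha> + z*\<beta> + (y\<^sup>2 - 1)*\<delta>)"
  using pal_sandwich[OF det(2,1), of \<alpha> \<delta> \<beta>]
  by (simp add: x_def y_def z_def pal_swap[of A B] trace_mul_sym[of B A] algebra_simps)

lemma sandwich_inv_A: "inv2 A ** pal_span A B \<alpha> \<beta> \<delta> ** inv2 A =
    pal_span A B ((x\<^sup>2 - 1)*\<alpha> + x*\<beta> + ((x*y - z)*x - y)*\<delta>) (-x*\<alpha> - \<beta> - (x*y - z)*\<delta>) \<delta>"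
  using det unfolding x_def y_def z_def
  by (simp add: mat2_simps pal_span_def trace2 det_2 inv2_def) (intro conjI; algebra)

lemma sandwich_inv_B: "inv2 B ** pal_span A B \<alpha> \<beta> \<delta> ** inv2 B =
    pal_span A B ((y\<^sup>2 - 1)*\<alpha> + ((x*y - z)*y - x)*\<beta> + y*\<delta>) \<beta> (-y*\<alpha> - (x*y - z)*\<beta> - \<delta>)"
  using det unfolding x_def y_def z_def
  by (simp add: mat2_simps pal_span_def trace2 det_2 inv2_def) (intro conjI; algebra)

lemma cancel:
  "inv2 A ** (A ** X) = X" "A ** (inv2 A ** X) = X" "inv2 B ** (B ** X) = X" "B ** (inv2 B ** X) = X"
  by (simp_all add: matrix_mul_assoc inv2_mult det)

lemma pal_units: "A = pal_span A B 0 1 0" "B = pal_span A B 0 0 1" "mat 1 = pal_span A B 1 0 0"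
  by (simp_all add: pal_span_def mat2_simps)

lemma pal_BAB: "B ** A ** B = pal_span A B (-x) 1 z"
  using sandwich_B[of 0 1 0] pal_units(1) by simp

lemma trace_C: "trace C = gamma_xyz x y z" "trace C' = gamma_xyz x y z"
  using det unfolding C_def C'_def x_def y_def z_def gamma_xyz_def
  by (simp_all add: mat2_simps trace2 det_2 inv2_def) algebra+

lemma det_C: "det C = 1" "det C' = 1"
  by (simp_all add: C_def C'_def det_mul det_inv2 det)

text \<open>After cancellation the word is b a (b^-1 a^-1 b^-1) a b, built from the inverse of A by
  three successive sandwiches.\<close>

lemma conj_A:
  "\<exists>\<alpha> \<beta>. C ** A ** C' = pal_span A B \<alpha> \<beta> (x*y - gamma_xyz x y z * z)"
proof -
  have "inv2 A = pal_span A B x (-1) 0"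
    by (simp add: inv2_def pal_span_def mat2_simps x_def)
  then have "inv2 B ** inv2 A ** inv2 B = pal_span A B (y * z) (-1) (-z)"
    using sandwich_inv_B[of x "-1" 0] by (simp add: algebra_simps power2_eq_square)
  then have "C ** A ** C' = B ** (A ** pal_span A B (y * z) (-1) (-z) ** A) ** B"
    unfolding C_def C'_def by (simp flip: matrix_mul_assoc add: cancel) (simp add: matrix_mul_assoc)
  then show ?thesis
    unfolding sandwich_A sandwich_B gamma_xyz_def
    by (rule pal_exI) algebra
qed

lemma conj_sum_A: "\<exists>\<alpha> \<beta>. C ** A + A ** C' = pal_span A B \<alpha> \<beta> (x*y - 2*z)"
proof -
  have "C ** A + A ** C' = B ** A ** inv2 B + inv2 B ** A ** B"
    unfolding C_def C'_def by (simp flip: matrix_mul_assoc add: cancel inv2_mult det)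
  then show ?thesis
    using pal_conj_sum(1)[OF det] unfolding x_def y_def z_def by auto
qed

lemma conj_BAB:
  "\<exists>\<alpha> \<beta>. C ** (B ** A ** B) ** C' = pal_span A B \<alpha> \<beta>
    (x*y - z + (gamma_xyz x y z)\<^sup>2 * z - gamma_xyz x y z * (x*y))"
proof -
  have "C ** (B ** A ** B) ** C' = B ** (A ** (inv2 B ** (inv2 A ** (B ** A ** B) ** inv2 A) ** inv2 B) ** A) ** B"
    unfolding C_def C'_def by (simp flip: matrix_mul_assoc add: cancel)
  then show ?thesis
    unfolding pal_BAB sandwich_A sandwich_B sandwich_inv_A sandwich_inv_B gamma_xyz_def
    by (rule pal_exI) algebra
qed

lemma conj_sum_BAB:
  "\<exists>\<alpha> \<beta>. C ** (B ** A ** B) + B ** A ** B ** C' = pal_span A B \<alpha> \<beta> (2 * gamma_xyz x y z * z - x*y)"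
proof -
  have "C ** (B ** A ** B) + B ** A ** B ** C' =
      B ** (A ** (inv2 B ** inv2 A ** B + B ** inv2 A ** inv2 B) ** A) ** B"
    unfolding C_def C'_def
    by (simp flip: matrix_mul_assoc add: cancel matrix_add_ldistrib matrix_add_rdistrib)
  then show ?thesis
    unfolding pal_conj_sum(2)[OF det, folded x_def y_def z_def] sandwich_A sandwich_B gamma_xyz_def
    by (rule pal_exI) algebra
qed

text \<open>The middle matrix A has B-coefficient 0, so the t^2 term drops out and a factor s splits
  off.\<close>

lemma mat_pow_conj_A:
  fixes n defines "s \<equiv> poly (cheb (Suc n)) (gamma_xyz x y z)" and "t \<equiv> poly (cheb n) (gamma_xyz x y z)"
  shows "\<exists>\<alpha> \<beta>. mat_pow C (Suc n) ** A ** mat_pow C' (Suc n) =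
    pal_span A B \<alpha> \<beta> (((x*y - gamma_xyz x y z * z) * s - (x*y - 2*z) * t) * s)"
proof -
  obtain \<alpha>\<^sub>1 \<beta>\<^sub>1 \<alpha>\<^sub>2 \<beta>\<^sub>2 where 1: "C ** A ** C' = pal_span A B \<alpha>\<^sub>1 \<beta>\<^sub>1 (x*y - gamma_xyz x y z * z)"
    and 2: "C ** A + A ** C' = pal_span A B \<alpha>\<^sub>2 \<beta>\<^sub>2 (x*y - 2*z)"
    using conj_A conj_sum_A by blast
  have "mat_pow C (Suc n) = shift_mat s C t" "mat_pow C' (Suc n) = shift_mat s C' t"
    by (simp_all only: mat_pow_eq[OF det_C(1)] mat_pow_eq[OF det_C(2)] trace_C s_def t_def) simp_all
  then have "mat_pow C (Suc n) ** A ** mat_pow C' (Suc n) = shift_mat s C t ** A ** shift_mat s C' t" by simp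
  from this[unfolded shift_mat_sandwich[OF 1 2 pal_units(1)]] show ?thesis
   
    by (rule pal_exI) algebra
qed

text \<open>Substituting t = \<gamma> s - s' turns the B-coefficient into z s'^2 - xy s s' + (xy -
  z) s^2, which vanishes at s' = s and therefore factors.\<close>

lemma mat_pow_conj_BAB:
  fixes n defines "s \<equiv> poly (cheb n) (gamma_xyz x y z)" and "s' \<equiv> poly (cheb (Suc n)) (gamma_xyz x y z)"
  shows "\<exists>\<alpha> \<beta>. mat_pow C n ** (B ** A ** B) ** mat_pow C' n =
    pal_span A B \<alpha> \<beta> ((z * s' - (x*y - z) * s) * (s' - s))"
proof -
  define t where "t = gamma_xyz x y z * s - s'"
  obtain \<alpha>\<^sub>1 \<beta>\<^sub>1 \<alpha>\<^sub>2 \<beta>\<^sub>2 where 1: "C ** (B ** A ** B) ** C' = pal_span A B \<alpha>\<^sub>1 \<beta>\<^sub>1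
      (x*y - z + (gamma_xyz x y z)\<^sup>2 * z - gamma_xyz x y z * (x*y))"
    and 2: "C ** (B ** A ** B) + B ** A ** B ** C' = pal_span A B \<alpha>\<^sub>2 \<beta>\<^sub>2 (2 * gamma_xyz x y z * z - x*y)"
    using conj_BAB conj_sum_BAB by blast
  have "mat_pow C n = shift_mat s C t" "mat_pow C' n = shift_mat s C' t"
    by (simp_all only: mat_pow_eq[OF det_C(1)] mat_pow_eq[OF det_C(2)] trace_C s_def s'_def t_def)
  then have "mat_pow C n ** (B ** A ** B) ** mat_pow C' n = shift_mat s C t ** (B ** A ** B) ** shift_mat s C' t" by simp
  from this[unfolded shift_mat_sandwich[OF 1 2 pal_BAB]] show ?thesis
    unfolding t_def
    by (rule pal_exI) algebra
qed

end

section \<open>The twisted Whitehead links\<close>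

definition whitehead_letter :: "nat \<Rightarrow> nat \<Rightarrow> meridian \<times> bool" where
  "whitehead_letter k j = (if odd j then Mer_b else Mer_a, even ((2 * k + 1) * j div (4 * k + 4)))"

lemma whitehead_word: "two_bridge_word (2 * k + 2) (2 * k + 1) = map (whitehead_letter k) [1..<4 * k + 4]"
proof -
  have "2 * (2 * k + 2) = 4 * k + 4" by simp
  then show ?thesis
    unfolding two_bridge_word_def whitehead_letter_def
    by (simp only: floor_divide_of_nat_eq even_of_nat_iff)
qed

text \<open>The quotient is j/2 - j/(4k + 4), and up to the midpoint j = 2k + 2 the subtracted term
  is positive and at most 1/2.\<close>

lemma whitehead_letter_low:
  assumes "1 \<le> j" "j \<le> 2 * k + 2"
  shows "whitehead_letter k j = (if odd j then Mer_b else Mer_a, even ((j - 1) div 2))"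
proof -
  define q where "q = (j - 1) div 2"
  have "j = 2 * q + 1 \<or> j = 2 * q + 2" using assms(1) unfolding q_def by presburger
  then have "(2 * k + 1) * j div (4 * k + 4) = q"
    using assms(2) by (intro div_nat_eqI) (auto simp: algebra_simps)
  then show ?thesis by (simp add: whitehead_letter_def q_def)
qed

text \<open>From the midpoint on, the term subtracted from j/2 is at least 1/2 and less than
  1.\<close>

lemma whitehead_letter_high:
  assumes "2 * k + 2 \<le> j" "j < 4 * k + 4"
  shows "whitehead_letter k j = (if odd j then Mer_b else Mer_a, odd (j div 2))"
proof -
  define q where "q = j div 2 - 1"
  have j: "j = 2 * q + 2 \<or> j = 2 * q + 3" using assms(1) unfolding q_def by presburger
  \<comment> \<open>An odd j lies strictly beyond the even midpoint, so the subtracted term then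
    exceeds 1/2 and the quotient stays below q + 1.\<close>
  then have "k \<le> q \<or> j = 2 * q + 2" using assms(1) by presburger
  with j have "(2 * k + 1) * j div (4 * k + 4) = q"
    using assms by (intro div_nat_eqI) (auto simp: algebra_simps)
  moreover have "even q \<longleftrightarrow> odd (j div 2)" using j by auto
  ultimately show ?thesis by (simp add: whitehead_letter_def)
qed

lemma upt_append_4:
  assumes "a \<le> b"
  shows "[a..<b + 4] = [a..<b] @ [b, b + 1, b + 2, b + 3]"
proof -
  have "[b..<b + 4] = [b, b + 1, b + 2, b + 3]"
    by (simp add: upt_conv_Cons numeral_eq_Suc)
  then show ?thesis using upt_add_eq_append[OF assms, of 4] by (simp only:)
qed

lemma word_val_low:
  fixes A B :: "complex^2^2"
  assumes "4 * i \<le> 2 * k + 2"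
  shows "word_val (case_meridian A B) (map (whitehead_letter k) [1..<4 * i + 1]) =
    mat_pow (B ** A ** inv2 B ** inv2 A) i"
  using assms
proof (induction i)
  case (Suc i)
  have "[1..<4 * Suc i + 1] = [1..<4 * i + 1] @ [4 * i + 1, 4 * i + 2, 4 * i + 3, 4 * i + 4]"
    using upt_append_4[of 1 "4 * i + 1"] by (simp only: mult_Suc_right) (simp add: ac_simps)
  moreover have "(4 * i + 3) div 2 = 2 * i + 1" "(4 * i + 2) div 2 = 2 * i + 1" "(4 * i + 1) div 2 = 2 * i"
    "(3 + 4 * i) div 2 = 2 * i + 1"
    by presburger+
  then have "whitehead_letter k (4 * i + 1) = (Mer_b, True)" "whitehead_letter k (4 * i + 2) = (Mer_a, True)"
    "whitehead_letter k (4 * i + 3) = (Mer_b, False)" "whitehead_letter k (4 * i + 4) = (Mer_a, False)"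
    using Suc.prems whitehead_letter_low[of "4 * i + 1" k] whitehead_letter_low[of "4 * i + 2" k]
      whitehead_letter_low[of "4 * i + 3" k] whitehead_letter_low[of "4 * i + 4" k] by simp_all
  moreover have "word_val (case_meridian A B) (map (whitehead_letter k) [1..<4 * i + 1]) =
      mat_pow (B ** A ** inv2 B ** inv2 A) i"
    using Suc by simp
  ultimately show ?case
    by (simp only: word_val_append map_append list.map) (simp add: matrix_mul_assoc)
qed simp

lemma word_val_high:
  fixes A B :: "complex^2^2"
  assumes "2 * k + 2 \<le> 4 * t" "4 * t + 4 * i \<le> 4 * k + 4"
  shows "word_val (case_meridian A B) (map (whitehead_letter k) [4 * t..<4 * t + 4 * i]) =
    mat_pow (inv2 A ** inv2 B ** A ** B) i"
  using assms(2)
proof (induction i)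
  case (Suc i)
  have split: "[4 * t..<4 * t + 4 * Suc i] = [4 * t..<4 * t + 4 * i] @
      [4 * (t + i), 4 * (t + i) + 1, 4 * (t + i) + 2, 4 * (t + i) + 3]"
    using upt_append_4[of "4 * t" "4 * t + 4 * i"]
    by (simp only: mult_Suc_right distrib_left) (simp add: ac_simps)
  have "(4 * (t + i) + 3) div 2 = 2 * (t + i) + 1" "(4 * (t + i) + 2) div 2 = 2 * (t + i) + 1"
    "(4 * (t + i) + 1) div 2 = 2 * (t + i)" "4 * (t + i) div 2 = 2 * (t + i)"
    by presburger+
  then have letters: "whitehead_letter k (4 * (t + i)) = (Mer_a, False)" "whitehead_letter k (4 * (t + i) + 1) = (Mer_b, False)"
    "whitehead_letter k (4 * (t + i) + 2) = (Mer_a, True)" "whitehead_letter k (4 * (t + i) + 3) = (Mer_b, True)"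
    using Suc.prems assms(1) whitehead_letter_high[of k "4 * (t + i)"] whitehead_letter_high[of k "4 * (t + i) + 1"]
      whitehead_letter_high[of k "4 * (t + i) + 2"] whitehead_letter_high[of k "4 * (t + i) + 3"] by simp_all
  have "word_val (case_meridian A B) (map (whitehead_letter k) [4 * t..<4 * t + 4 * i]) =
      mat_pow (inv2 A ** inv2 B ** A ** B) i"
    using Suc by simp
  then show ?case
    by (simp only: split letters word_val_append map_append list.map) (simp add: matrix_mul_assoc)
qed simp

text \<open>The word of \<open>W\<^bsub>2n-1\<^esub>\<close> is \<open>[b,a]\<^sup>n a [a\<^sup>-\<^sup>1,b\<^sup>-\<^sup>1]\<^sup>n\<close> before free reduction.\<close>

lemma word_val_odd:
  fixes A B :: "complex^2^2"
  assumes "det A = 1" and k: "k + 1 = 2 * n"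
  shows "word_val (case_meridian A B) (two_bridge_word (2 * k + 2) (2 * k + 1)) =
    mat_pow (B ** A ** inv2 B ** inv2 A) n ** A ** mat_pow (inv2 A ** inv2 B ** A ** B) n"
proof -
  have le: "2 * k + 2 \<le> 4 * n" "4 * n < 4 * k + 4" "4 * n \<le> 2 * k + 2" "4 * n + 4 * n \<le> 4 * k + 4" "1 \<le> 4 * n"
    and len: "4 * k + 4 = 4 * n + 4 * n"
    using k by linarith+
  define M where "M = word_val (case_meridian A B) (map (whitehead_letter k) [1..<4 * n])"
  have letter: "whitehead_letter k (4 * n) = (Mer_a, False)"
    unfolding whitehead_letter_high[OF le(1,2)] by simp
  \<comment> \<open>The letter a^-1 at the midpoint 4n both ends the block of C and begins the block
    of C'. Counting it in both is compensated by the a between them.\<close>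
  have "[1..<4 * n + 1] = [1..<4 * n] @ [4 * n]" using le(5) by simp
  then have "word_val (case_meridian A B) (map (whitehead_letter k) [1..<4 * n + 1]) = M ** inv2 A"
    by (simp only: word_val_append map_append list.map letter M_def) simp
  then have "M ** inv2 A ** A = mat_pow (B ** A ** inv2 B ** inv2 A) n ** A"
    by (simp only: word_val_low[OF le(3)])
  then have M: "M = mat_pow (B ** A ** inv2 B ** inv2 A) n ** A"
    by (simp only: matrix_mul_assoc[symmetric] inv2_mult(2)[OF assms(1)] matrix_mul_rid)
  have "[1..<4 * k + 4] = [1..<4 * n] @ [4 * n..<4 * n + 4 * n]"
    unfolding len using le(5) by (rule upt_add_eq_append)
  then show ?thesis
    by (simp only: whitehead_word word_val_append map_append word_val_high[OF le(1,4)] M[unfolded M_def])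
qed

text \<open>The 8n + 3 letters split as 4n + 3 + 4n, with the middle bab centred at the midpoint 4n
  + 2.\<close>

lemma word_val_even:
  fixes A B :: "complex^2^2"
  shows "word_val (case_meridian A B) (two_bridge_word (2 * (2 * n) + 2) (2 * (2 * n) + 1)) =
    mat_pow (B ** A ** inv2 B ** inv2 A) n ** (B ** A ** B) ** mat_pow (inv2 A ** inv2 B ** A ** B) n"
proof -
  have len: "4 * (2 * n) + 4 = 4 * n + 1 + (3 + 4 * n)" "4 * n + 1 + 3 = 4 * (n + 1)"
    "4 * n + 1 + (3 + 4 * n) = 4 * (n + 1) + 4 * n"
    by simp_all
  have "[4 * n + 1..<4 * n + 1 + 3] = [4 * n + 1, 4 * n + 2, 4 * n + 3]"
    by (simp add: upt_conv_Cons numeral_3_eq_3)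
  moreover have "[1..<4 * n + 1 + (3 + 4 * n)] = [1..<4 * n + 1] @ [4 * n + 1..<4 * n + 1 + (3 + 4 * n)]"
    by (rule upt_add_eq_append) simp
  moreover have "[4 * n + 1..<4 * n + 1 + 3 + 4 * n] = [4 * n + 1..<4 * n + 1 + 3] @ [4 * n + 1 + 3..<4 * n + 1 + 3 + 4 * n]"
    by (rule upt_add_eq_append) simp
  ultimately have split: "[1..<4 * (2 * n) + 4] =
      [1..<4 * n + 1] @ [4 * n + 1, 4 * n + 2, 4 * n + 3] @ [4 * (n + 1)..<4 * (n + 1) + 4 * n]"
    unfolding len by (simp only: add.assoc[symmetric] len(2))
  have "(4 * n + 3) div 2 = 2 * n + 1" "(4 * n + 1) div 2 = 2 * n" by presburger+
  then have letters: "whitehead_letter (2 * n) (4 * n + 1) = (Mer_b, True)" "whitehead_letter (2 * n) (4 * n + 2) = (Mer_a, True)"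
    "whitehead_letter (2 * n) (4 * n + 3) = (Mer_b, True)"
    using whitehead_letter_low[of "4 * n + 1" "2 * n"] whitehead_letter_low[of "4 * n + 2" "2 * n"]
      whitehead_letter_high[of "2 * n" "4 * n + 3"] by simp_all
  have "word_val (case_meridian A B) (map (whitehead_letter (2 * n)) [1..<4 * n + 1]) =
      mat_pow (B ** A ** inv2 B ** inv2 A) n"
    "word_val (case_meridian A B) (map (whitehead_letter (2 * n)) [4 * (n + 1)..<4 * (n + 1) + 4 * n]) =
      mat_pow (inv2 A ** inv2 B ** A ** B) n"
    by (rule word_val_low, simp, rule word_val_high, simp_all)
  then show ?thesis
    by (simp only: whitehead_word split letters word_val_append map_append list.map)
      (simp add: matrix_mul_assoc)
qed

lemma whitehead_character_variety_eq:
  "whitehead_character_variety k =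
    character_variety
      (presented_group {([(Mer_a, True)] @ two_bridge_word (2 * k + 2) (2 * k + 1),
        two_bridge_word (2 * k + 2) (2 * k + 1) @ [(Mer_a, True)])})
      (gen_elem {([(Mer_a, True)] @ two_bridge_word (2 * k + 2) (2 * k + 1),
        two_bridge_word (2 * k + 2) (2 * k + 1) @ [(Mer_a, True)])} Mer_a)
      (gen_elem {([(Mer_a, True)] @ two_bridge_word (2 * k + 2) (2 * k + 1),
        two_bridge_word (2 * k + 2) (2 * k + 1) @ [(Mer_a, True)])} Mer_b)"
  by (simp only: whitehead_character_variety_def whitehead_relations_def two_bridge_relations_def Let_def)

section \<open>The varieties and their components\<close>

lemma variety_odd:
  "whitehead_character_variety (2 * Suc m - 1) =
    {(x, y, z). gamma_xyz x y z = 2 \<or>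
      ((x * y - gamma_xyz x y z * z) * poly (cheb (Suc m)) (gamma_xyz x y z)
        - (x * y - 2 * z) * poly (cheb m) (gamma_xyz x y z)) * poly (cheb (Suc m)) (gamma_xyz x y z) = 0}"
  unfolding whitehead_character_variety_eq
proof (rule character_variety_palindrome)
  fix A B :: "complex^2^2" assume "det A = 1" "det B = 1"
  then show "\<exists>\<alpha> \<beta>. word_val (case_meridian A B) (two_bridge_word (2 * (2 * Suc m - 1) + 2) (2 * (2 * Suc m - 1) + 1)) =
    pal_span A B \<alpha> \<beta> (((trace A * trace B - gamma_xyz (trace A) (trace B) (trace (A ** B)) * trace (A ** B)) *
         poly (cheb (Suc m)) (gamma_xyz (trace A) (trace B) (trace (A ** B))) -
        (trace A * trace B - 2 * trace (A ** B)) * poly (cheb m) (gamma_xyz (trace A) (trace B) (trace (A ** B)))) *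
       poly (cheb (Suc m)) (gamma_xyz (trace A) (trace B) (trace (A ** B))))"
    using mat_pow_conj_A[of A B m]
    by (subst word_val_odd[where n = "Suc m"]) (simp_all only:, simp)
qed

lemma variety_even:
  "whitehead_character_variety (2 * n) =
    {(x, y, z). gamma_xyz x y z = 2 \<or>
      (z * poly (cheb (Suc n)) (gamma_xyz x y z) - (x * y - z) * poly (cheb n) (gamma_xyz x y z)) *
        (poly (cheb (Suc n)) (gamma_xyz x y z) - poly (cheb n) (gamma_xyz x y z)) = 0}"
  unfolding whitehead_character_variety_eq
proof (rule character_variety_palindrome)
  fix A B :: "complex^2^2" assume "det A = 1" "det B = 1"
  then show "\<exists>\<alpha> \<beta>. word_val (case_meridian A B) (two_bridge_word (2 * (2 * n) + 2) (2 * (2 * n) + 1)) =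
    pal_span A B \<alpha> \<beta> ((trace (A ** B) * poly (cheb (Suc n)) (gamma_xyz (trace A) (trace B) (trace (A ** B))) -
        (trace A * trace B - trace (A ** B)) * poly (cheb n) (gamma_xyz (trace A) (trace B) (trace (A ** B)))) *
       (poly (cheb (Suc n)) (gamma_xyz (trace A) (trace B) (trace (A ** B))) -
        poly (cheb n) (gamma_xyz (trace A) (trace B) (trace (A ** B)))))"
    unfolding word_val_even by (rule mat_pow_conj_BAB)
qed

text \<open>Collecting z and xy in the last factor gives d = S_{m+1} - S_{m-1} and e = S_m -
  S_{m-1}, with r = 2 - t. The levels are 2 and the m roots of S_m, distinct from 2 as S_m(2) = m +
  1.\<close>

lemma components_odd:
  "card (irreducible_components (whitehead_character_variety (2 * Suc m - 1))) = Suc m + 1"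
proof -
  define d where "d = cheb (Suc (Suc m)) - cheb m"
  define e where "e = cheb (Suc m) - cheb m"
  define C where "C = insert 2 {t. poly (cheb (Suc m)) t = 0}"
  have "2 \<notin> {t. poly (cheb (Suc m)) t = 0}"
    by (simp only: mem_Collect_eq poly_cheb_2 of_nat_eq_0_iff)
  moreover have "finite {t. poly (cheb (Suc m)) t = 0}" by (rule poly_roots_finite[OF cheb_Suc_nonzero])
  ultimately have "card C = Suc m" "finite C"
    using cheb_roots(2)[of "Suc m"] by (simp_all add: C_def del: cheb.simps)
  have "degree (- cheb m) < Suc m" using degree_cheb_le[of m] by simp
  from degree_cheb_add[OF disjI1[OF this]] have d: "degree d = Suc m" "d \<noteq> 0" by (simp_all add: d_def)
  have "degree e \<le> m" unfolding e_def
    using degree_cheb[of m] degree_cheb_le[of m] by (intro degree_diff_le) auto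
  then have e: "e = 0 \<or> degree e < degree d" using d by simp
  have const: "[:2, 1:] = 2 + [:0, 1::complex:]" "[:2, -1:] = 2 - [:0, 1::complex:]"
    by (simp_all add: numeral_poly)
  have "d\<^sup>2 - [:2, 1:] * e * (d - e) = [:2, -1:] * ((cheb (Suc m))\<^sup>2 + (cheb m)\<^sup>2 - [:0, 1:] * cheb m * cheb (Suc m))"
    unfolding d_def e_def cheb.simps const by algebra
  then have r: "d\<^sup>2 - [:2, 1:] * e * (d - e) = [:2, -1:]" by (simp only: cheb_norm mult_1_right)
  \<comment> \<open>A common zero of d and e is a zero of r = 2 - t, but d(2) = (m + 2) - m =
    2.\<close>
  have coprime: "poly e t \<noteq> 0" if "poly d t = 0" for t
  proof
    assume "poly e t = 0"
    then have "t = 2" using arg_cong[OF r, of "\<lambda>p. poly p t"] that by simp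
    then show False using that by (simp add: d_def poly_cheb_2 del: cheb.simps)
  qed
  have surface: "(x * y - t * z) * poly (cheb (Suc m)) t - (x * y - 2 * z) * poly (cheb m) t = 0 \<longleftrightarrow>
    z * poly d t = x * y * poly e t" for x y z t
  proof -
    have "(x * y - t * z) * poly (cheb (Suc m)) t - (x * y - 2 * z) * poly (cheb m) t =
        x * y * poly e t - z * poly d t"
      by (simp add: d_def e_def algebra_simps)
    then show ?thesis by auto
  qed
  have C: "t \<in> C \<longleftrightarrow> t = 2 \<or> poly (cheb (Suc m)) t = 0" for t by (simp only: C_def insert_iff mem_Collect_eq)
  have eq: "whitehead_character_variety (2 * Suc m - 1) = {(x, y, z). gamma_xyz x y z \<in> C \<or>
    z * poly d (gamma_xyz x y z) = x * y * poly e (gamma_xyz x y z)}"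
    unfolding variety_odd mult_eq_0_iff[of _ "poly (cheb (Suc m)) _"] surface C by (simp only: disj_ac)
  have "[:2, -1::complex:] \<noteq> 0" by simp
  from card_components_two_bridge[OF d(2) e this r coprime \<open>finite C\<close>]
  show ?thesis unfolding eq \<open>card C = Suc m\<close> .
qed

text \<open>Here d = S_n + S_{n-1} and e = S_{n-1}, with r = 1, so d and e have no common zero. The
  levels are 2 and the n roots of S_n - S_{n-1}, whose value at 2 is 1. For n = 0 one has e = 0 and
  d = 1.\<close>

lemma components_even:
  "card (irreducible_components (whitehead_character_variety (2 * n))) = n + 2"
proof -
  define d where "d = cheb (Suc n) + cheb n"
  define C where "C = insert 2 {t. poly (cheb (Suc n) - cheb n) t = 0}"
  have deg: "degree (cheb n) < n \<or> cheb n = 0" using degree_cheb_le[of n] by (cases "n = 0") auto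
  then have "degree (- cheb n) < n \<or> - cheb n = 0" by simp
  from degree_cheb_add(2)[OF this] have "cheb (Suc n) - cheb n \<noteq> 0" by simp
  then have fin: "finite {t. poly (cheb (Suc n) - cheb n) t = 0}" by (rule poly_roots_finite)
  have "2 \<notin> {t. poly (cheb (Suc n) - cheb n) t = 0}"
    by (simp only: mem_Collect_eq poly_diff poly_cheb_2) simp
  from card_insert_disjoint[OF fin this] have "card C = Suc n" "finite C"
    using fin by (simp_all only: C_def cheb_diff_roots(2) finite_insert)
  have d: "degree d = n" "d \<noteq> 0" using degree_cheb_add[OF deg] by (simp_all add: d_def)
  have const: "[:2, 1:] = 2 + [:0, 1::complex:]" by (simp add: numeral_poly)
  have "d\<^sup>2 - [:2, 1:] * cheb n * (d - cheb n) =
      (cheb (Suc n))\<^sup>2 + (cheb n)\<^sup>2 - [:0, 1:] * cheb n * cheb (Suc n)"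
    unfolding d_def const by algebra
  then have r: "d\<^sup>2 - [:2, 1:] * cheb n * (d - cheb n) = 1" by (simp only: cheb_norm)
  have coprime: "poly (cheb n) t \<noteq> 0" if "poly d t = 0" for t
    using arg_cong[OF r, of "\<lambda>p. poly p t"] that by auto
  have surface: "z * poly (cheb (Suc n)) t - (x * y - z) * poly (cheb n) t = 0 \<longleftrightarrow>
    z * poly d t = x * y * poly (cheb n) t" for x y z t
  proof -
    have "z * poly (cheb (Suc n)) t - (x * y - z) * poly (cheb n) t =
        z * poly d t - x * y * poly (cheb n) t"
      by (simp add: d_def algebra_simps)
    then show ?thesis by auto
  qed
  have C: "t \<in> C \<longleftrightarrow> t = 2 \<or> poly (cheb (Suc n)) t - poly (cheb n) t = 0" for t
    by (simp only: C_def insert_iff mem_Collect_eq poly_diff)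
  have eq: "whitehead_character_variety (2 * n) = {(x, y, z). gamma_xyz x y z \<in> C \<or>
    z * poly d (gamma_xyz x y z) = x * y * poly (cheb n) (gamma_xyz x y z)}"
    unfolding variety_even mult_eq_0_iff[of _ "poly (cheb (Suc n)) _ - _"] surface C by (simp only: disj_ac)
  have "cheb n = 0 \<or> degree (cheb n) < degree d" using deg d(1) by auto
  from card_components_two_bridge[OF d(2) this one_neq_zero r coprime \<open>finite C\<close>]
  show ?thesis unfolding eq \<open>card C = Suc n\<close> by simp
qed

theorem theorem3:
  shows "(\<forall>n::nat. n \<ge> 1 \<longrightarrow>
      whitehead_character_variety (2 * n - 1) =
        {(x, y, z). let \<gamma> = gamma_xyz x y z in
          (\<gamma> - 2) *
          ((x * y - \<gamma> * z) * chebyshev_S (int n - 1) \<gamma>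
            - (x * y - 2 * z) * chebyshev_S (int n - 2) \<gamma>) *
          (\<Prod>j = 1..n - 1. \<gamma> - complex_of_real (2 * cos (real j * pi / real n))) = 0}
      \<and> card (irreducible_components (whitehead_character_variety (2 * n - 1))) = n + 1)
    \<and> (\<forall>n::nat.
      whitehead_character_variety (2 * n) =
        {(x, y, z). let \<gamma> = gamma_xyz x y z in
          (\<gamma> - 2) *
          (z * chebyshev_S (int n) \<gamma> - (x * y - z) * chebyshev_S (int n - 1) \<gamma>) *
          (\<Prod>j = 1..n. \<gamma> - complex_of_real (2 * cos ((2 * real j - 1) * pi / real (2 * n + 1)))) = 0}
      \<and> card (irreducible_components (whitehead_character_variety (2 * n))) = n + 2)"
proof (intro conjI allI impI)
  fix n :: nat assume "n \<ge> 1"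
  then obtain m where n: "n = Suc m" by (cases n) auto
  show "card (irreducible_components (whitehead_character_variety (2 * n - 1))) = n + 1"
    unfolding n by (rule components_odd)
  have S: "chebyshev_S (int n - 1) t = poly (cheb (Suc m)) t" "chebyshev_S (int n - 2) t = poly (cheb m) t" for t
    using chebyshev_S_eq_cheb[of n t] chebyshev_S_eq_cheb[of m t] by (simp_all only: n) simp
  \<comment> \<open>Only the zero sets matter, so the product over the known roots can stand for the
    Chebyshev factor.\<close>
  have "(\<Prod>j = 1..n - 1. t - complex_of_real (2 * cos (real j * pi / real n))) = 0 \<longleftrightarrow> poly (cheb (Suc m)) t = 0" for t
  proof -
    have "t \<in> (\<lambda>j. of_real (2 * cos (real j * pi / real n))) ` {1..n - 1} \<longleftrightarrow> poly (cheb (Suc m)) t = 0"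
      unfolding cheb_roots(1)[OF \<open>n \<ge> 1\<close>, symmetric] by (simp only: n mem_Collect_eq)
    then show ?thesis by (auto simp: image_iff)
  qed
  then show "whitehead_character_variety (2 * n - 1) =
        {(x, y, z). let \<gamma> = gamma_xyz x y z in
          (\<gamma> - 2) *
          ((x * y - \<gamma> * z) * chebyshev_S (int n - 1) \<gamma>
            - (x * y - 2 * z) * chebyshev_S (int n - 2) \<gamma>) *
          (\<Prod>j = 1..n - 1. \<gamma> - complex_of_real (2 * cos (real j * pi / real n))) = 0}"
    unfolding n variety_odd Let_def S[unfolded n] mult_eq_0_iff[of _ "prod _ _"]
      mult_eq_0_iff[of "_ - 2"] mult_eq_0_iff[of _ "poly (cheb (Suc m)) _"] eq_iff_diff_eq_0[of _ 2]
    by (simp only: disj_assoc n)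
next
  fix n :: nat
  show "card (irreducible_components (whitehead_character_variety (2 * n))) = n + 2"
    by (rule components_even)
  have S: "chebyshev_S (int n - 1) t = poly (cheb n) t" "chebyshev_S (int n) t = poly (cheb (Suc n)) t" for t
    using chebyshev_S_eq_cheb[of n t] chebyshev_S_eq_cheb[of "Suc n" t] by (simp_all del: cheb.simps)
  have "(\<Prod>j = 1..n. t - complex_of_real (2 * cos ((2 * real j - 1) * pi / real (2 * n + 1)))) = 0 \<longleftrightarrow>
      poly (cheb (Suc n)) t - poly (cheb n) t = 0" for t
  proof -
    have "t \<in> (\<lambda>j. of_real (2 * cos ((2 * real j - 1) * pi / real (2 * n + 1)))) ` {1..n} \<longleftrightarrow>
        poly (cheb (Suc n)) t - poly (cheb n) t = 0"
      unfolding cheb_diff_roots(1)[symmetric] by (simp only: poly_diff mem_Collect_eq)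
    then show ?thesis by (auto simp: image_iff)
  qed
  then show "whitehead_character_variety (2 * n) =
        {(x, y, z). let \<gamma> = gamma_xyz x y z in
          (\<gamma> - 2) *
          (z * chebyshev_S (int n) \<gamma> - (x * y - z) * chebyshev_S (int n - 1) \<gamma>) *
          (\<Prod>j = 1..n. \<gamma> - complex_of_real (2 * cos ((2 * real j - 1) * pi / real (2 * n + 1)))) = 0}"
    unfolding variety_even Let_def S mult_eq_0_iff[of _ "prod _ _"]
      mult_eq_0_iff[of "_ - 2"] mult_eq_0_iff[of _ "poly (cheb (Suc n)) _ - _"] eq_iff_diff_eq_0[of _ 2]
    by (simp only: disj_assoc)
qed

end
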